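(* Let $\alpha$ be a fixed constant. For inputs $(A,d,c,x^* )$ to CONFIG-SP (see context) with $|\{i\in\{1,\dots,n\}: x^*_i\in(0,1)\}|\le\alpha$, a $(1,k)$-configuration inequality (for some $k$), with respect to some row constraint of $Ax\le d$, that is violated by $x^*$ can be found in polynomial time, if one exists.
   Context: $\mathbb{Z}_+$ denotes the nonnegative integers. An input to CONFIG-SP consists of $A\in\mathbb{Z}_+^{m\times n}$, $d\in\mathbb{Z}_+^m$, $c\in\mathbb{Z}_+^n$ and an optimal solution $x^*$ to the LP relaxation $\max\{c^{\mathsf T}x: Ax\le d,\ x\in[0,1]^n\}$. With respect to a row constraint $a^{\mathsf T}x\le b$ of $Ax\le d$: a cover is a set $C\subseteq\{1,\dots,n\}$ with $\sum_{i\in C}a_i>b$; a minimal cover is a cover $C$ with $\sum_{i\in C\setminus\{j\}}a_i\le b$ for every $j\in C$. A set $N\cup\{t\}$ with $N\subsetneq\{1,\dots,n\}$ and $t\in\{1,\dots,n\}\setminus N$ is a $(1,k)$-configuration, for $k\in\{2,\dots,|N|\}$, if $\sum_{i\in N}a_i\le b$ and $Q\cup\{t\}$ is a minimal cover for every $Q\subseteq N$ with $|Q|=k$. Its $(1,k)$-configuration inequalities are $(|S|-k+1)x_t+\sum_{i\in S}x_i\le|S|$ for $S\subseteq N$ with $|S|\ge k$. "Violated by $x^*$" (separating) means that $x^*$ does not satisfy the inequality. *)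

theory Defs
  imports
    "Jordan_Normal_Form.Matrix"
    "HOL-Computational_Algebra.Polynomial"
    "HOL-Library.Discrete_Functions"
begin

section \<open>Polynomial time\<close>

text \<open>
  The machine model is the random access machine with the logarithmic cost criterion of Aho,
  Hopcroft and Ullman, with structured control flow instead of jumps and with memory divided into
  arrays. A program names its arrays by constants, so it uses only finitely many of them;
  \<open>s r i\<close> is the content of cell \<open>i\<close> of array \<open>r\<close> in store \<open>s\<close>.
  Subtraction is truncated at \<open>0\<close>, and division is rounded down.
\<close>

type_synonym store = "nat \<Rightarrow> nat \<Rightarrow> nat"

datatype expr =
    Num nat
  | Cell nat expr
  | Add expr expr
  | Sub expr expr
  | Mul expr expr
  | Div expr expr

datatype prog =
    Skip
  | Assign nat expr expr
  | Seq prog prog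
  | Cond expr prog prog
  | While expr prog

definition bit_length :: "nat \<Rightarrow> nat" where
  "bit_length k = floor_log k + 1"

fun val :: "store \<Rightarrow> expr \<Rightarrow> nat" where
  "val s (Num k) = k"
| "val s (Cell r e) = s r (val s e)"
| "val s (Add e f) = val s e + val s f"
| "val s (Sub e f) = val s e - val s f"
| "val s (Mul e f) = val s e * val s f"
| "val s (Div e f) = val s e div val s f"

text \<open>
  Every node pays for the bit length of its own value, so that all operands, all addresses and all
  results are paid for.
\<close>

fun expr_cost :: "store \<Rightarrow> expr \<Rightarrow> nat" where
  "expr_cost s (Num k) = bit_length k"
| "expr_cost s (Cell r e) = expr_cost s e + bit_length (val s (Cell r e))"
| "expr_cost s (Add e f) = expr_cost s e + expr_cost s f + bit_length (val s (Add e f))"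
| "expr_cost s (Sub e f) = expr_cost s e + expr_cost s f + bit_length (val s (Sub e f))"
| "expr_cost s (Mul e f) = expr_cost s e + expr_cost s f + bit_length (val s (Mul e f))"
| "expr_cost s (Div e f) = expr_cost s e + expr_cost s f + bit_length (val s (Div e f))"

text \<open>
  \<open>exec p s t s'\<close>: started in \<open>s\<close>, the program \<open>p\<close> halts in \<open>s'\<close> at total cost \<open>t\<close>.
  A test succeeds iff the value of its expression is nonzero. \<open>Assign r e f\<close> stores the value of
  \<open>f\<close> in the cell of array \<open>r\<close> whose address is the value of \<open>e\<close>.
\<close>

inductive exec :: "prog \<Rightarrow> store \<Rightarrow> nat \<Rightarrow> store \<Rightarrow> bool" where
  Skip: "exec Skip s 1 s"
| Assign: "exec (Assign r e f) s (1 + expr_cost s e + expr_cost s f)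
             (s(r := (s r)(val s e := val s f)))"
| Seq: "exec p s t s' \<Longrightarrow> exec q s' t' s'' \<Longrightarrow> exec (Seq p q) s (t + t') s''"
| CondTrue: "val s e \<noteq> 0 \<Longrightarrow> exec p s t s' \<Longrightarrow>
             exec (Cond e p q) s (1 + expr_cost s e + t) s'"
| CondFalse: "val s e = 0 \<Longrightarrow> exec q s t s' \<Longrightarrow>
             exec (Cond e p q) s (1 + expr_cost s e + t) s'"
| WhileFalse: "val s e = 0 \<Longrightarrow> exec (While e p) s (1 + expr_cost s e) s"
| WhileTrue: "val s e \<noteq> 0 \<Longrightarrow> exec p s t s' \<Longrightarrow> exec (While e p) s' t' s'' \<Longrightarrow>
             exec (While e p) s (1 + expr_cost s e + t + t') s''"

text \<open>
  Inputs and outputs are lists of natural numbers. Such a list is held in an array by its length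
  in cell \<open>0\<close> and its entries in the cells from \<open>1\<close> on. The input is in array \<open>0\<close>, the output is
  in array \<open>1\<close>, and all other cells are initially \<open>0\<close>.
\<close>

definition initial_store :: "nat list \<Rightarrow> store" where
  "initial_store ws = (\<lambda>r i. if r = 0 \<and> i \<le> length ws then (length ws # ws) ! i else 0)"

definition output_of :: "store \<Rightarrow> nat list" where
  "output_of s = map (\<lambda>i. s 1 (Suc i)) [0..<s 1 0]"

definition word_size :: "nat list \<Rightarrow> nat" where
  "word_size ws = (\<Sum>w\<leftarrow>ws. bit_length w)"

text \<open>
  A search problem consists of a set \<open>I\<close> of admissible inputs, a binary encoding \<open>enc\<close> of inputs,
  and the relation \<open>R\<close> between inputs and their correct (encoded) outputs. Nothing is required of a
  program on inputs outside \<open>I\<close>. The size of the output is counted as well, because the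
  program need not have touched the cells that it outputs.
\<close>

definition solvable_in_poly_time ::
    "'i set \<Rightarrow> ('i \<Rightarrow> nat list) \<Rightarrow> ('i \<Rightarrow> nat list \<Rightarrow> bool) \<Rightarrow> bool" where
  "solvable_in_poly_time I enc R \<longleftrightarrow>
     (\<exists>(p :: prog) (f :: nat poly). \<forall>inp\<in>I. \<exists>t s.
        exec p (initial_store (enc inp)) t s \<and>
        t + word_size (output_of s) \<le> poly f (word_size (enc inp)) \<and>
        R inp (output_of s))"


section \<open>(1,k)-configurations\<close>

text \<open>
  The constraint \<open>a\<^sup>T x \<le> b\<close> is given by \<open>a\<close> and \<open>b\<close>. Indices range over
  \<open>{0,\<dots>,n-1}\<close> instead of \<open>{1,\<dots>,n}\<close>.
\<close>

definition cover :: "nat vec \<Rightarrow> nat \<Rightarrow> nat set \<Rightarrow> bool" where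
  "cover a b C \<longleftrightarrow> C \<subseteq> {..<dim_vec a} \<and> (\<Sum>i\<in>C. a $ i) > b"

definition minimal_cover :: "nat vec \<Rightarrow> nat \<Rightarrow> nat set \<Rightarrow> bool" where
  "minimal_cover a b C \<longleftrightarrow> cover a b C \<and> (\<forall>j\<in>C. (\<Sum>i\<in>C - {j}. a $ i) \<le> b)"

definition configuration :: "nat vec \<Rightarrow> nat \<Rightarrow> nat \<Rightarrow> nat set \<Rightarrow> nat \<Rightarrow> bool" where
  "configuration a b k N t \<longleftrightarrow>
     N \<subset> {..<dim_vec a} \<and> t \<in> {..<dim_vec a} - N \<and> k \<in> {2..card N} \<and>
     (\<Sum>i\<in>N. a $ i) \<le> b \<and>
     (\<forall>Q. Q \<subseteq> N \<and> card Q = k \<longrightarrow> minimal_cover a b (Q \<union> {t}))"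

definition satisfies_configuration_inequality ::
    "nat \<Rightarrow> nat set \<Rightarrow> nat \<Rightarrow> real vec \<Rightarrow> bool" where
  "satisfies_configuration_inequality k S t x \<longleftrightarrow>
     (real (card S) - real k + 1) * x $ t + (\<Sum>i\<in>S. x $ i) \<le> real (card S)"


section \<open>CONFIG-SP\<close>

definition lp_feasible :: "nat mat \<Rightarrow> nat vec \<Rightarrow> real vec \<Rightarrow> bool" where
  "lp_feasible A d x \<longleftrightarrow>
     x \<in> carrier_vec (dim_col A) \<and>
     map_mat real A *\<^sub>v x \<le> map_vec real d \<and>
     (\<forall>i<dim_vec x. 0 \<le> x $ i \<and> x $ i \<le> 1)"

definition lp_optimal :: "nat mat \<Rightarrow> nat vec \<Rightarrow> nat vec \<Rightarrow> real vec \<Rightarrow> bool" where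
  "lp_optimal A d c x \<longleftrightarrow>
     lp_feasible A d x \<and>
     (\<forall>y. lp_feasible A d y \<longrightarrow> map_vec real c \<bullet> y \<le> map_vec real c \<bullet> x)"

text \<open>The solution is rational, as it is part of a finite input.\<close>

record config_sp =
  matrix :: "nat mat"
  rhs :: "nat vec"
  objective :: "nat vec"
  solution :: "rat vec"

definition real_solution :: "config_sp \<Rightarrow> real vec" where
  "real_solution P = map_vec real_of_rat (solution P)"

definition config_sp_input :: "config_sp \<Rightarrow> bool" where
  "config_sp_input P \<longleftrightarrow>
     rhs P \<in> carrier_vec (dim_row (matrix P)) \<and>
     objective P \<in> carrier_vec (dim_col (matrix P)) \<and>
     lp_optimal (matrix P) (rhs P) (objective P) (real_solution P)"

definition fractional :: "config_sp \<Rightarrow> nat set" where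
  "fractional P = {i. i < dim_col (matrix P) \<and> solution P $ i \<in> {0<..<1}}"

text \<open>
  The encoding lists the numbers of rows and columns, the matrix row by row, the right-hand side,
  the objective, and then the numerators and the denominators of the solution in lowest terms. The
  solution is nonnegative, so nothing is lost by the conversion of the numerators.
\<close>

definition encode_input :: "config_sp \<Rightarrow> nat list" where
  "encode_input P =
     [dim_row (matrix P), dim_col (matrix P)] @
     concat (mat_to_list (matrix P)) @
     list_of_vec (rhs P) @
     list_of_vec (objective P) @
     map (\<lambda>q. nat (fst (quotient_of q))) (list_of_vec (solution P)) @
     map (\<lambda>q. nat (snd (quotient_of q))) (list_of_vec (solution P))"

text \<open>
  \<open>violated_inequality P r k N t S\<close>: with respect to row \<open>r\<close>, \<open>N \<union> {t}\<close> is a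
  \<open>(1,k)\<close>-configuration, and the inequality that it has for \<open>S\<close> is violated.
\<close>

definition violated_inequality ::
    "config_sp \<Rightarrow> nat \<Rightarrow> nat \<Rightarrow> nat set \<Rightarrow> nat \<Rightarrow> nat set \<Rightarrow> bool" where
  "violated_inequality P r k N t S \<longleftrightarrow>
     r < dim_row (matrix P) \<and>
     configuration (row (matrix P) r) (rhs P $ r) k N t \<and>
     S \<subseteq> N \<and> card S \<ge> k \<and>
     \<not> satisfies_configuration_inequality k S t (real_solution P)"

definition indicator_list :: "nat \<Rightarrow> nat set \<Rightarrow> nat list" where
  "indicator_list n X = map (\<lambda>i. if i \<in> X then 1 else 0) [0..<n]"

definition encode_inequality ::
    "config_sp \<Rightarrow> nat \<Rightarrow> nat \<Rightarrow> nat set \<Rightarrow> nat \<Rightarrow> nat set \<Rightarrow> nat list" where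
  "encode_inequality P r k N t S =
     [r, k, t] @ indicator_list (dim_col (matrix P)) N @ indicator_list (dim_col (matrix P)) S"

text \<open>The empty list reports that no inequality is violated.\<close>

definition separates :: "config_sp \<Rightarrow> nat list \<Rightarrow> bool" where
  "separates P ys \<longleftrightarrow>
     (if \<exists>r k N t S. violated_inequality P r k N t S
      then \<exists>r k N t S. violated_inequality P r k N t S \<and> ys = encode_inequality P r k N t S
      else ys = [])"

end

theory Submission
  imports Defs
begin

text \<open>
  Restricting \<open>N\<close> to \<open>S\<close> preserves the configuration, so it suffices to search for \<open>(k, S, t)\<close> with
  \<open>N = S\<close>. Let \<open>F\<close> be the set of fractional indices and \<open>O\<close> the set of indices \<open>i\<close> with \<open>x\<^sub>i = 1\<close>. If some
  inequality is violated, then there is a violated one whose \<open>S\<close> differs, apart from \<open>t\<close>, in at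
  most \<open>|F|\<^sup>2 + 2|F|\<close> places from a set \<open>{i \<in> O. i \<ge> j \<and> a\<^sub>i + a\<^sub>t \<le> b}\<close>, where indices are ordered by weight.

  If \<open>|S| = k\<close> is possible, then \<open>S \<union> {t}\<close> is a minimal cover; adding all elements of \<open>O\<close> that form
  no two-element cover with its fractional part, and then keeping only the heaviest elements
  needed, gives another one, which has at least three elements because no pair is a cover.
  Otherwise, for \<open>|S|\<close> minimal, \<open>S\<close> has no index with \<open>x\<^sub>i = 0\<close>, fewer than \<open>k\<close> indices in \<open>O\<close>, and thus
  \<open>q = |S| - k < |S \<inter> F|\<close>. The elements of \<open>O\<close> compatible with \<open>t\<close> form no cover together with \<open>t\<close>
  (or else the first case would apply), so those missing in \<open>S\<close> weigh less than \<open>S \<inter> F\<close>. The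
  \<open>q + 1\<close> lightest elements of \<open>S\<close> outweigh any \<open>q\<close> elements of \<open>S\<close>, so the heaviest element
  is less than \<open>q + 1\<close> times the \<open>(q + 1)\<close>-st lightest one, \<open>j\<close>. Hence fewer than \<open>|F|\<^sup>2\<close> missing elements
  are as heavy as \<open>j\<close>.

  For fixed \<open>\<alpha>\<close> there are polynomially many candidates, and each of them can be tested: with
  the \<open>k\<close>-th lightest and the \<open>(k - 1)\<close>-st heaviest element of \<open>S\<close> guessed as well, the defining
  conditions become finitely many comparisons of sums.
\<close>

section \<open>Violated inequalities near a threshold set\<close>

lemma obtain_max:
  fixes f :: "'a \<Rightarrow> nat"
  assumes "finite S" "S \<noteq> {}"
  obtains m where "m \<in> S" "\<And>i. i \<in> S \<Longrightarrow> f i \<le> f m"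
proof -
  have "Max (f ` S) \<in> f ` S" using assms by (intro Max_in) auto
  then obtain m where "m \<in> S" "Max (f ` S) = f m" by auto
  then show thesis using that[of m] assms(1) by (metis Max_ge finite_imageI imageI)
qed

lemma obtain_min:
  fixes f :: "'a \<Rightarrow> nat"
  assumes "finite S" "S \<noteq> {}"
  obtains m where "m \<in> S" "\<And>i. i \<in> S \<Longrightarrow> f m \<le> f i"
proof -
  have "Min (f ` S) \<in> f ` S" using assms by (intro Min_in) auto
  then obtain m where "m \<in> S" "Min (f ` S) = f m" by auto
  then show thesis using that[of m] assms(1) by (metis Min_le finite_imageI imageI)
qed

text \<open>By induction on the size of \<open>S\<close>. The element of largest value handles
  \<open>c = card S\<close>; removing it leaves the sets \<open>{i \<in> S. f i \<le> f p}\<close>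
  of all other \<open>p\<close> unchanged, because \<open>f\<close> is injective.\<close>

lemma ex_card_le_threshold:
  fixes f :: "'a \<Rightarrow> nat"
  assumes "finite S" "inj_on f S" "1 \<le> c" "c \<le> card S"
  shows "\<exists>p\<in>S. card {i \<in> S. f i \<le> f p} = c"
  using assms
proof (induction "card S" arbitrary: S)
  case 0
  then show ?case by simp
next
  case (Suc u)
  from Suc.hyps(2) Suc.prems(1) have "S \<noteq> {}" by auto
  then obtain m where m: "m \<in> S" "\<And>i. i \<in> S \<Longrightarrow> f i \<le> f m"
    using Suc.prems(1) obtain_max by metis
  show ?case
  proof (cases "c = card S")
    case True
    have "{i \<in> S. f i \<le> f m} = S" using m by auto
    with True m show ?thesis by metis
  next
    case False
    have "u = card (S - {m})" using Suc.hyps(2) m(1) Suc.prems(1) by simp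
    moreover have "inj_on f (S - {m})" using Suc.prems(2) by (rule inj_on_diff)
    moreover have "c \<le> card (S - {m})" using False Suc.prems m(1) by simp
    ultimately obtain p where p: "p \<in> S - {m}" "card {i \<in> S - {m}. f i \<le> f p} = c"
      using Suc.hyps(1)[of "S - {m}"] Suc.prems(1,3) by blast
    have "f p < f m"
      using m(1) m(2)[of p] p(1) inj_onD[OF Suc.prems(2), of p m] by (auto simp: order_less_le)
    then have "{i \<in> S - {m}. f i \<le> f p} = {i \<in> S. f i \<le> f p}" by auto
    with p show ?thesis by auto
  qed
qed

text \<open>The complement of a lower set, together with its threshold \<open>p\<close>, is the
  upper set at \<open>p\<close>. So a lower set of size \<open>card S - c + 1\<close> yields an
  upper set of size \<open>c\<close>.\<close>

lemma ex_card_ge_threshold: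
  fixes f :: "'a \<Rightarrow> nat"
  assumes "finite S" "inj_on f S" "1 \<le> c" "c \<le> card S"
  shows "\<exists>p\<in>S. card {i \<in> S. f p \<le> f i} = c"
proof -
  have "1 \<le> card S - c + 1" "card S - c + 1 \<le> card S" using assms(3,4) by linarith+
  then obtain p where p: "p \<in> S" "card {i \<in> S. f i \<le> f p} = card S - c + 1"
    using ex_card_le_threshold[OF assms(1,2)] by blast
  have "{i \<in> S. f p \<le> f i} = insert p (S - {i \<in> S. f i \<le> f p})"
    using p(1) assms(2) by (auto simp: inj_on_def)
  moreover have "card (insert p (S - {i \<in> S. f i \<le> f p})) = Suc (card S - (card S - c + 1))"
    using assms(1) p by (subst card_insert_disjoint) (auto simp: card_Diff_subset)
  ultimately show ?thesis using p(1) assms(3,4) by (intro bexI[of _ p]) auto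
qed

lemma sum_le_sum_same_card:
  fixes a :: "'a \<Rightarrow> nat"
  assumes "finite X" "finite Y" "card X = card Y" "\<And>i j. i \<in> X \<Longrightarrow> j \<in> Y \<Longrightarrow> a i \<le> a j"
  shows "sum a X \<le> sum a Y"
proof -
  obtain h where h: "bij_betw h X Y"
    using finite_same_card_bij[OF assms(1-3)] by blast
  have "sum a X \<le> sum (\<lambda>i. a (h i)) X"
    using h assms(4) by (intro sum_mono) (auto simp: bij_betw_def)
  also have "\<dots> = sum a Y" by (rule sum.reindex_bij_betw[OF h])
  finally show ?thesis .
qed

text \<open>The common elements cancel, and the two differences have equal size. Only the
  differences need to be compared, which is possible when one of the sets consists of the lightest
  or the heaviest elements.\<close>

lemma sum_le_sum_exchange:
  fixes a :: "'a \<Rightarrow> nat"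
  assumes "finite L" "finite Q" "card L = card Q"
    "\<And>i j. i \<in> L - Q \<Longrightarrow> j \<in> Q - L \<Longrightarrow> a i \<le> a j"
  shows "sum a L \<le> sum a Q"
proof -
  have "card (L - Q) = card (Q - L)"
    using card_Diff_subset_Int[of L Q] card_Diff_subset_Int[of Q L] assms(1-3)
    by (simp add: Int_commute)
  then have "sum a (L - Q) \<le> sum a (Q - L)"
    using assms by (intro sum_le_sum_same_card) auto
  moreover have "sum a L = sum a (L - Q) + sum a (L \<inter> Q)"
    using assms(1) by (metis add.commute sum.Int_Diff)
  moreover have "sum a Q = sum a (Q - L) + sum a (L \<inter> Q)"
    using assms(2) by (metis add.commute sum.Int_Diff Int_commute)
  ultimately show ?thesis by simp
qed

section \<open>Configurations and covers of a single row\<close>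

locale row_point =
  fixes n b :: nat and a :: "nat \<Rightarrow> nat" and x :: "nat \<Rightarrow> real"
  assumes x_bounds: "i < n \<Longrightarrow> 0 \<le> x i \<and> x i \<le> 1"
    and row_feasible: "(\<Sum>i<n. real (a i) * x i) \<le> real b"
begin

text \<open>Orders the indices by weight and breaks ties by the index itself.\<close>

definition key :: "nat \<Rightarrow> nat" where
  "key i = a i * n + i"

definition ones :: "nat set" where
  "ones = {i. i < n \<and> x i = 1}"

definition fracs :: "nat set" where
  "fracs = {i. i < n \<and> 0 < x i \<and> x i < 1}"

text \<open>
  That \<open>sum a Q \<le> b\<close> for \<open>|Q| = k\<close>, the part of minimality concerning the removal of \<open>t\<close>, follows from
  \<open>sum a S \<le> b\<close>.
\<close>

definition config :: "nat \<Rightarrow> nat set \<Rightarrow> nat \<Rightarrow> bool" where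
  "config k S t \<longleftrightarrow> S \<subseteq> {..<n} \<and> t < n \<and> t \<notin> S \<and> 2 \<le> k \<and> k \<le> card S \<and> sum a S \<le> b \<and>
     (\<forall>Q\<subseteq>S. card Q = k \<longrightarrow> b < a t + sum a Q) \<and>
     (\<forall>Q\<subseteq>S. card Q = k - 1 \<longrightarrow> a t + sum a Q \<le> b)"

definition violating :: "nat \<Rightarrow> nat set \<Rightarrow> nat \<Rightarrow> bool" where
  "violating k S t \<longleftrightarrow>
     config k S t \<and> real (card S) < (real (card S) - real k + 1) * x t + sum x S"

text \<open>The condition \<open>a i + a t \<le> b\<close> holds for all elements of a configuration
  by \<open>config_pair_le\<close>. The index \<open>t\<close> itself may belong to this set, so it
  is excepted wherever \<open>S\<close> is compared with it.\<close>

definition base :: "nat \<Rightarrow> nat \<Rightarrow> nat set" where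
  "base t j = {i \<in> ones. key j \<le> key i \<and> a i + a t \<le> b}"

text \<open>For indices below \<open>n\<close>, the key has the index as its remainder modulo
  \<open>n\<close>.\<close>

lemma inj_on_key: "inj_on key {..<n}"
proof (rule inj_onI)
  fix i j assume ij: "i \<in> {..<n}" "j \<in> {..<n}" "key i = key j"
  then have "(i + a i * n) mod n = (j + a j * n) mod n" by (simp add: key_def add.commute)
  then have "i mod n = j mod n" by (simp only: mod_mult_self1)
  with ij show "i = j" by simp
qed

lemma key_le_imp_le: "a i \<le> a j" if "key i \<le> key j" "j < n"
proof (rule ccontr)
  assume "\<not> a i \<le> a j"
  then have "Suc (a j) * n \<le> a i * n" by (intro mult_le_mono1) simp
  then show False using that by (simp add: key_def)
qed

lemma finite_sub: "S \<subseteq> {..<n} \<Longrightarrow> finite S"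
  by (rule finite_subset[OF _ finite_lessThan])

lemma sum_real_le:
  assumes "T \<subseteq> {..<n}"
  shows "(\<Sum>i\<in>T. real (a i) * x i) \<le> real b"
proof -
  have "(\<Sum>i\<in>T. real (a i) * x i) \<le> (\<Sum>i<n. real (a i) * x i)"
    using assms x_bounds by (intro sum_mono2) auto
  with row_feasible show ?thesis by linarith
qed

text \<open>The point has value 1 on \<open>T\<close>, so the weight of \<open>T\<close> is part of
  the left-hand side of the row constraint. This is how feasibility enters the argument: a cover
  always contains an index outside \<open>ones\<close>.\<close>

lemma sum_ones_le:
  assumes "T \<subseteq> ones"
  shows "sum a T \<le> b"
proof -
  have "real (sum a T) = (\<Sum>i\<in>T. real (a i) * x i)"
    using assms by (auto simp: ones_def intro!: sum.cong)
  also have "\<dots> \<le> real b" using assms by (intro sum_real_le) (auto simp: ones_def)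
  finally show ?thesis by (simp only: of_nat_le_iff)
qed

lemma two_ones_le: "a i + a j \<le> b" if "i \<in> ones" "j \<in> ones" "i \<noteq> j"
  using sum_ones_le[of "{i, j}"] that by simp

lemma config_subset:
  assumes "config k S t" "T \<subseteq> S" "k \<le> card T"
  shows "config k T t"
proof -
  have "finite S" using assms(1) finite_sub by (simp add: config_def)
  then have "sum a T \<le> sum a S" using assms(2) by (intro sum_mono2) auto
  then have "sum a T \<le> b" using assms(1) by (simp add: config_def)
  with assms show ?thesis unfolding config_def by auto
qed

text \<open>Since \<open>k\<close> is at least 2, \<open>i\<close> extends to a subset of
  \<open>S\<close> with \<open>k - 1\<close> elements, and this subset weighs at most
  \<open>b\<close> together with \<open>t\<close>.\<close>

lemma config_pair_le:
  assumes "config k S t" "i \<in> S"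
  shows "a i + a t \<le> b"
proof -
  have fin: "finite S" using assms(1) finite_sub by (simp add: config_def)
  have "1 \<le> k - 1" "k - 1 \<le> card S" using assms(1) by (auto simp: config_def)
  then obtain Q where Q: "{i} \<subseteq> Q" "Q \<subseteq> S" "card Q = k - 1"
    using exists_subset_between[of "{i}" "k - 1" S] assms(2) fin by auto
  then have "a t + sum a Q \<le> b" using assms(1) by (simp add: config_def)
  moreover have "a i \<le> sum a Q"
    using Q fin by (intro member_le_sum) (auto intro: finite_subset)
  ultimately show ?thesis by simp
qed

text \<open>\<open>P\<close> consists of the heaviest elements of \<open>D\<close>, as few as still
  form a cover. Dropping its lightest element destroys the cover, hence so does dropping any
  element. No single element and no pair is a cover, so \<open>P\<close> has at least three elements
  and \<open>k = card P - 1\<close> is at least 2. For any \<open>t\<close> in \<open>P\<close>, the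
  inequality is violated because the slacks 1 - x i over \<open>P\<close> sum to less than
  1.\<close>

lemma minimal_cover_prefix:
  assumes D: "D \<subseteq> {..<n}" and cov: "b < sum a D" and single: "\<And>i. i \<in> D \<Longrightarrow> a i \<le> b"
    and pair: "\<And>i j. i \<in> D \<Longrightarrow> j \<in> D \<Longrightarrow> i \<noteq> j \<Longrightarrow> a i + a j \<le> b"
    and slack: "(\<Sum>i\<in>D. 1 - x i) < 1"
  obtains j P where "j \<in> D" "P = {i \<in> D. key j \<le> key i}" "b < sum a P"
    "\<And>t. t \<in> P \<Longrightarrow> violating (card P - 1) (P - {t}) t"
proof -
  have fin: "finite D" using D by (rule finite_sub)
  \<comment> \<open>The starting points of upper sets that are covers; the one with the largest key
    gives the smallest such set.\<close>
  define J where "J = {j \<in> D. b < sum a {i \<in> D. key j \<le> key i}}"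
  have "D \<noteq> {}" using cov by auto
  then obtain l where l: "l \<in> D" "\<And>i. i \<in> D \<Longrightarrow> key l \<le> key i"
    using fin obtain_min by metis
  then have "{i \<in> D. key l \<le> key i} = D" by auto
  with cov l have "l \<in> J" by (simp add: J_def)
  moreover have "finite J" using fin by (simp add: J_def)
  ultimately obtain j where j: "j \<in> J" "\<And>i. i \<in> J \<Longrightarrow> key i \<le> key j"
    using obtain_max[of J key] by blast
  define P where "P = {i \<in> D. key j \<le> key i}"
  have jD: "j \<in> D" and covP: "b < sum a P" using j by (auto simp: J_def P_def)
  have finP: "finite P" using fin by (simp add: P_def)
  have PD: "P \<subseteq> D" by (auto simp: P_def)
  have jP: "j \<in> P" using jD by (simp add: P_def)
  \<comment> \<open>Otherwise \<open>P - {j}\<close> would itself be an upper set that is a cover,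
    starting at the index \<open>j'\<close> with the next larger key, against the choice of
    \<open>j\<close>.\<close>
  have minj: "sum a (P - {j}) \<le> b"
  proof (rule ccontr)
    assume *: "\<not> sum a (P - {j}) \<le> b"
    then have "P - {j} \<noteq> {}" by (metis le0 sum.empty)
    then obtain j' where j': "j' \<in> P - {j}" "\<And>i. i \<in> P - {j} \<Longrightarrow> key j' \<le> key i"
      using finP obtain_min[of "P - {j}" key] by blast
    have "j' \<in> D" "j' \<noteq> j" "key j \<le> key j'" using j'(1) by (simp_all add: P_def)
    moreover from this have "key j \<noteq> key j'"
      using inj_onD[OF inj_on_key, of j j'] jD D by blast
    ultimately have lt: "key j < key j'" by simp
    have "{i \<in> D. key j' \<le> key i} = P - {j}"
    proof (intro equalityI subsetI)
      fix i assume "i \<in> {i \<in> D. key j' \<le> key i}"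
      with lt show "i \<in> P - {j}" by (auto simp: P_def)
    next
      fix i assume i: "i \<in> P - {j}"
      with j'(2)[OF i] show "i \<in> {i \<in> D. key j' \<le> key i}" by (simp add: P_def)
    qed
    with * \<open>j' \<in> D\<close> have "j' \<in> J" by (simp add: J_def)
    with lt show False using j(2)[of j'] by simp
  qed
  have minP: "sum a (P - {i}) \<le> b" if "i \<in> P" for i
  proof -
    have "a j \<le> a i" using that D by (intro key_le_imp_le) (auto simp: P_def)
    moreover have "sum a (P - {i}) + a i = sum a (P - {j}) + a j"
      using sum.remove[OF finP that, of a] sum.remove[OF finP jP, of a] by simp
    ultimately show ?thesis using minj by linarith
  qed
  have card3: "3 \<le> card P"
  proof (rule ccontr)
    assume "\<not> 3 \<le> card P"
    then consider "card P = 0" | "card P = 1" | "card P = 2" by linarith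
    then show False
    proof cases
      case 1 then show False using covP finP by simp
    next
      case 2 then obtain i where "P = {i}" by (auto simp: card_1_singleton_iff)
      then show False using covP single[of i] PD by simp
    next
      case 3 then obtain i i' where "P = {i, i'}" "i \<noteq> i'" by (auto simp: card_2_iff)
      then show False using covP pair[of i i'] PD by simp
    qed
  qed
  have slackP: "(\<Sum>i\<in>P. 1 - x i) < 1"
  proof -
    have "(\<Sum>i\<in>P. 1 - x i) \<le> (\<Sum>i\<in>D. 1 - x i)"
      using fin PD D x_bounds by (intro sum_mono2) auto
    with slack show ?thesis by linarith
  qed
  have viol: "violating (card P - 1) (P - {t}) t" if "t \<in> P" for t
  proof -
    have c: "card (P - {t}) = card P - 1" using that finP by simp
    have add: "a t + sum a (P - {t}) = sum a P" using sum.remove[OF finP that, of a] by simp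
    \<comment> \<open>Such a \<open>Q\<close> misses just one element \<open>i\<close> of
      \<open>P - {t}\<close>, so together with \<open>t\<close> it is
      \<open>P - {i}\<close>.\<close>
    have sub: "a t + sum a Q \<le> b" if Q: "Q \<subseteq> P - {t}" "card Q = card P - 1 - 1" for Q
    proof -
      have "card ((P - {t}) - Q) = 1"
        using Q c card3 finP by (subst card_Diff_subset) (auto intro: finite_subset)
      then obtain i where i: "(P - {t}) - Q = {i}" by (auto simp: card_1_singleton_iff)
      then have "insert t Q = P - {i}" "t \<notin> Q" "i \<in> P" using Q(1) \<open>t \<in> P\<close> by blast+
      moreover from Q(1) finP have "finite Q" by (auto intro: finite_subset)
      ultimately show ?thesis using minP[of i] sum.insert[of Q t a] by simp
    qed
    have "config (card P - 1) (P - {t}) t"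
    proof -
      have "b < a t + sum a Q" if "Q \<subseteq> P - {t}" "card Q = card P - 1" for Q
        using card_subset_eq[of "P - {t}" Q] that c finP add covP by simp
      moreover have "P - {t} \<subseteq> {..<n}" "t < n" "t \<notin> P - {t}" using that PD D by auto
      moreover have "2 \<le> card P - 1" "card P - 1 \<le> card (P - {t})" using c card3 by simp_all
      ultimately show ?thesis unfolding config_def using minP[OF that] sub by blast
    qed
    moreover have "real (card P - 1) < x t + sum x (P - {t})"
    proof -
      have "real (card P) - sum x P < 1" using slackP by (simp add: sum_subtractf)
      moreover have "sum x P = x t + sum x (P - {t})" using sum.remove[OF finP that, of x] by simp
      ultimately show ?thesis using card3 by (simp add: of_nat_diff)
    qed
    ultimately show ?thesis unfolding violating_def c by simp
  qed
  show thesis using that[of j P] jD covP viol by (auto simp: P_def)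
qed

section \<open>Violated inequalities with \<open>card S = k\<close>\<close>

lemma config_cover_pair_le:
  assumes c: "config k S t" and ij: "i \<in> insert t S" "j \<in> insert t S" "i \<noteq> j"
  shows "a i + a j \<le> b"
proof -
  have "a i + a j \<le> b" if "i \<in> S" "j \<in> S"
  proof -
    have "finite S" using c finite_sub by (simp add: config_def)
    then have "sum a {i, j} \<le> sum a S" using that by (intro sum_mono2) auto
    then show ?thesis using ij(3) c by (simp add: config_def)
  qed
  then show ?thesis
    using ij config_pair_le[OF c, of i] config_pair_le[OF c, of j] by (auto simp: add.commute)
qed

lemma config_single_le:
  assumes c: "config k S t" and i: "i \<in> insert t S"
  shows "a i \<le> b"
proof -
  have "2 \<le> card S" using c by (simp add: config_def)
  then have "\<not> S \<subseteq> {i}" using card_mono[of "{i}" S] by auto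
  then obtain j where "j \<in> S" "i \<noteq> j" by auto
  then have "a i + a j \<le> b" using config_cover_pair_le[OF c i] by auto
  then show ?thesis by simp
qed

text \<open>The cover \<open>insert t S\<close> has total slack, the sum of 1 - x i, below 1. Adding
  elements of \<open>ones\<close> costs no slack, so all those compatible with the heaviest
  fractional element \<open>u\<close> are added before \<open>minimal_cover_prefix\<close> cuts off
  the light end. Taking \<open>u\<close> as the distinguished index makes the result agree with
  \<open>base u j\<close> outside \<open>fracs\<close>.\<close>

lemma tight_violating_near_base:
  assumes v: "violating (card S) S t"
  shows "\<exists>k S t j. j < n \<and> violating k S t \<and>
           (\<forall>i<n. i \<noteq> t \<longrightarrow> i \<notin> fracs \<longrightarrow> (i \<in> S \<longleftrightarrow> i \<in> base t j))"
proof -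
  have c: "config (card S) S t" using v by (simp add: violating_def)
  define C where "C = insert t S"
  have S: "S \<subseteq> {..<n}" "t < n" "t \<notin> S" using c by (auto simp: config_def)
  have finS: "finite S" using S(1) by (rule finite_sub)
  have finC: "finite C" using finS by (simp add: C_def)
  have Cn: "C \<subseteq> {..<n}" using S by (auto simp: C_def)
  have covC: "b < sum a C" using c S finS by (simp add: config_def C_def)
  have slackC: "(\<Sum>i\<in>C. 1 - x i) < 1"
    using v S(3) finS by (simp add: violating_def C_def sum_subtractf algebra_simps)
  \<comment> \<open>A single slack is less than 1, so no index in \<open>C\<close> has value
    0.\<close>
  have posC: "0 < x i" if "i \<in> C" for i
  proof -
    have "1 - x i \<le> (\<Sum>i\<in>C. 1 - x i)"
      using that finC Cn x_bounds by (intro member_le_sum) auto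
    with slackC show ?thesis by linarith
  qed
  have C_cases: "i \<in> ones \<or> i \<in> fracs" if "i \<in> C" for i
    using posC[OF that] that Cn x_bounds[of i] by (force simp: ones_def fracs_def)
  define F where "F = C \<inter> fracs"
  have finF: "finite F" using finC by (simp add: F_def)
  have "F \<noteq> {}"
  proof
    assume "F = {}"
    then have "C \<subseteq> ones" using C_cases by (auto simp: F_def)
    then show False using sum_ones_le covC by (meson not_le)
  qed
  then obtain u where u: "u \<in> F" "\<And>i. i \<in> F \<Longrightarrow> key i \<le> key u"
    using obtain_max[OF finF] by metis
  have un: "u < n" and uC: "u \<in> C" and uo: "u \<notin> ones"
    using u(1) by (auto simp: F_def fracs_def ones_def)
  define D where "D = F \<union> {i \<in> ones. a i + a u \<le> b}"
  have Dn: "D \<subseteq> {..<n}" using Cn by (auto simp: D_def F_def ones_def)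
  have finD: "finite D" using Dn by (rule finite_sub)
  have pairC: "a i + a j \<le> b" if "i \<in> C" "j \<in> C" "i \<noteq> j" for i j
    using config_cover_pair_le[OF c] that by (simp add: C_def)
  have CD: "C \<subseteq> D"
  proof
    fix i assume i: "i \<in> C"
    show "i \<in> D"
    proof (cases "i \<in> fracs")
      case True with i show ?thesis by (simp add: D_def F_def)
    next
      case False
      with i have "i \<in> ones" using C_cases by blast
      moreover from this uo have "i \<noteq> u" by auto
      ultimately show ?thesis using pairC[OF i uC] by (simp add: D_def)
    qed
  qed
  have covD: "b < sum a D"
    using covC sum_mono2[OF finD CD, of a] by simp
  have single: "a i \<le> b" if "i \<in> D" for i
    using that config_single_le[OF c, of i] sum_ones_le[of "{i}"]
    by (auto simp: D_def F_def C_def)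
  have fu: "a i \<le> a u" if "i \<in> F" for i
    using u(2)[OF that] un by (rule key_le_imp_le)
  \<comment> \<open>Compatibility with the elements of \<open>F\<close> need only be demanded for
    \<open>u\<close>, the heaviest of them.\<close>
  have pair: "a i + a j \<le> b" if ij: "i \<in> D" "j \<in> D" "i \<noteq> j" for i j
  proof -
    consider "i \<in> F" "j \<in> F" | "i \<in> F" "j \<in> ones" "a j + a u \<le> b"
      | "j \<in> F" "i \<in> ones" "a i + a u \<le> b" | "i \<in> ones" "j \<in> ones"
      using ij by (auto simp: D_def)
    then show ?thesis
    proof cases
      case 1 then show ?thesis using pairC ij(3) by (simp add: F_def)
    next
      case 2 then show ?thesis using fu[of i] by simp
    next
      case 3 then show ?thesis using fu[of j] by simp
    next
      case 4 then show ?thesis using two_ones_le ij(3) by simp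
    qed
  qed
  have slackD: "(\<Sum>i\<in>D. 1 - x i) < 1"
  proof -
    have "(\<Sum>i\<in>D. 1 - x i) = (\<Sum>i\<in>F. 1 - x i)"
      using finD by (intro sum.mono_neutral_right) (auto simp: D_def ones_def)
    also have "\<dots> \<le> (\<Sum>i\<in>C. 1 - x i)"
      using finC Cn x_bounds by (intro sum_mono2) (auto simp: F_def)
    finally show ?thesis using slackC by linarith
  qed
  obtain j P where P: "j \<in> D" "P = {i \<in> D. key j \<le> key i}" "b < sum a P"
    "\<And>t. t \<in> P \<Longrightarrow> violating (card P - 1) (P - {t}) t"
    using minimal_cover_prefix[OF Dn covD single pair slackD] by blast
  \<comment> \<open>A cover contains a fractional element; since \<open>P\<close> is an upper set in
    \<open>D\<close>, it then contains \<open>u\<close>, which has the largest key in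
    \<open>F\<close>.\<close>
  have "\<not> P \<subseteq> ones" using sum_ones_le P(3) by (meson not_le)
  then obtain f where f: "f \<in> P" "f \<notin> ones" by auto
  then have "f \<in> F" using P(2) by (auto simp: D_def)
  then have "key j \<le> key u" using f u(2)[of f] P(2) by auto
  then have uP: "u \<in> P" using u(1) P(2) by (auto simp: D_def)
  have "i \<in> P - {u} \<longleftrightarrow> i \<in> base u j" if "i \<noteq> u" "i \<notin> fracs" for i
    using that P(2) by (auto simp: D_def F_def base_def)
  moreover have "j < n" using P(1) Dn by auto
  ultimately show ?thesis using P(4)[OF uP] by blast
qed

section \<open>Violated inequalities with \<open>card S > k\<close>\<close>

text \<open>For a violated configuration with the least \<open>S\<close>, put
  \<open>q = card S - k\<close> and let \<open>f\<close> be the number of fractional indices in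
  \<open>S\<close>. The exceptional set \<open>X\<close> collects the elements of
  \<open>base t j\<close> missing from \<open>S\<close>, fewer than \<open>f * (q + 1)\<close>, the
  \<open>f\<close> fractional elements of \<open>S\<close>, and its \<open>q + 1\<close> lightest
  elements. The bound follows from \<open>q + 1 \<le> f\<close> and
  \<open>f \<le> card fracs\<close>.\<close>

lemma slack_violating_near_base:
  assumes v0: "violating k0 S0 t0" and no_tight: "\<And>S t. \<not> violating (card S) S t"
  shows "\<exists>k S t j X. j < n \<and> violating k S t \<and> finite X \<and>
           card X \<le> card fracs * card fracs + 2 * card fracs \<and> X \<subseteq> {..<n} \<and>
           (\<forall>i<n. i \<noteq> t \<longrightarrow> i \<notin> X \<longrightarrow> (i \<in> S \<longleftrightarrow> i \<in> base t j))"
proof -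
  define V where "V = (\<lambda>(k, S, t). violating k S t)"
  have "V (k0, S0, t0)" using v0 by (simp add: V_def)
  then obtain z where z: "V z" "\<And>y. V y \<Longrightarrow> card (fst (snd z)) \<le> card (fst (snd y))"
    using ex_has_least_nat[of V "(k0, S0, t0)" "\<lambda>y. card (fst (snd y))"] by blast
  obtain k S t where zz: "z = (k, S, t)" by (cases z)
  have v: "violating k S t" using z(1) zz by (simp add: V_def)
  have least: "card S \<le> card T" if "violating k T t" for T
    using z(2)[of "(k, T, t)"] that zz by (simp add: V_def)
  have c: "config k S t" using v by (simp add: violating_def)
  have S: "S \<subseteq> {..<n}" "t < n" "t \<notin> S" and k: "2 \<le> k" "k \<le> card S" using c by (auto simp: config_def)
  have finS: "finite S" using S(1) by (rule finite_sub)
  have finf: "finite fracs" by (simp add: fracs_def)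
  have kS: "k < card S" using k(2) v no_tight[of S t] by (cases "k = card S") auto
  have viol: "real (card S) < (real (card S) - real k + 1) * x t + sum x S"
    using v by (simp add: violating_def)
  \<comment> \<open>With \<open>x t = 0\<close> a violation would need the values on
    \<open>S\<close> to sum to more than \<open>card S\<close>.\<close>
  have xt: "0 < x t"
  proof (rule ccontr)
    assume "\<not> 0 < x t"
    then have "x t = 0" using x_bounds[OF S(2)] by linarith
    moreover have "sum x S \<le> real (card S) * 1"
      using S(1) x_bounds by (intro sum_bounded_above) auto
    ultimately show False using viol by simp
  qed
  \<comment> \<open>Removing an index of value 0 lowers the left-hand side by \<open>x t\<close>,
    which is at most 1, and the right-hand side by 1, so the inequality stays violated with a
    smaller \<open>S\<close>.\<close>
  have pos: "0 < x i" if i: "i \<in> S" for i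
  proof (rule ccontr)
    assume "\<not> 0 < x i"
    then have xi: "x i = 0" using x_bounds[of i] S(1) i by force
    have cS: "card (S - {i}) = card S - 1" using finS i by simp
    have "k \<le> card (S - {i})" unfolding cS using kS by simp
    then have "config k (S - {i}) t" using config_subset[OF c Diff_subset] by blast
    moreover have "real (card (S - {i})) < (real (card (S - {i})) - real k + 1) * x t + sum x (S - {i})"
    proof -
      have "sum x S = sum x (S - {i})" using sum.remove[OF finS i, of x] xi by simp
      moreover have "real (card (S - {i})) = real (card S) - 1" unfolding cS using kS by (simp add: of_nat_diff)
      moreover have "x t \<le> 1" using x_bounds[OF S(2)] by simp
      ultimately show ?thesis using viol by (simp add: algebra_simps)
    qed
    ultimately have "violating k (S - {i}) t" by (simp add: violating_def)
    then have "card S \<le> card S - 1" using least cS by metis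
    then show False using kS by simp
  qed
  have S_cases: "i \<in> ones \<or> i \<in> fracs" if "i \<in> S" for i
    using pos[OF that] that S(1) x_bounds[of i] by (force simp: ones_def fracs_def)
  \<comment> \<open>Any \<open>k\<close> elements of value 1 in \<open>S\<close> would give a
    violated inequality of the excluded tight kind, because \<open>x t\<close> is positive.\<close>
  have few_ones: "card (S \<inter> ones) < k"
  proof (rule ccontr)
    assume "\<not> card (S \<inter> ones) < k"
    then obtain Q where Q: "Q \<subseteq> S \<inter> ones" "card Q = k"
      by (meson not_less obtain_subset_with_card_n)
    have "config k Q t" using config_subset[OF c, of Q] Q by simp
    moreover have "sum x Q = real (card Q)" using Q(1) by (simp add: ones_def subset_iff)
    ultimately have "violating (card Q) Q t" using Q xt by (simp add: violating_def)
    then show False using no_tight by blast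
  qed
  define q where "q = card S - k"
  define f where "f = card (S \<inter> fracs)"
  have split: "S = (S \<inter> ones) \<union> (S \<inter> fracs)" "(S \<inter> ones) \<inter> (S \<inter> fracs) = {}"
    using S_cases by (auto simp: ones_def fracs_def)
  have "card S = card (S \<inter> ones) + f"
    using card_Un_disjoint[OF _ _ split(2)] split(1) finS by (simp add: f_def)
  then have qf: "q + 1 \<le> f" using few_ones kS by (simp add: q_def)
  have f_le: "f \<le> card fracs" using finf by (auto simp: f_def intro: card_mono)
  have sumS: "sum a S = sum a (S \<inter> ones) + sum a (S \<inter> fracs)"
    using sum.union_disjoint[OF _ _ split(2), of a] split(1) finS by simp
  define Z where "Z = {i \<in> ones. i \<noteq> t \<and> a i + a t \<le> b}"
  have Zn: "Z \<subseteq> {..<n}" by (auto simp: Z_def ones_def)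
  have finZ: "finite Z" using Zn by (rule finite_sub)
  have "t \<notin> Z" by (simp add: Z_def)
  have SZ: "S \<inter> ones \<subseteq> Z" using config_pair_le[OF c] S(3) by (auto simp: Z_def)
  \<comment> \<open>Otherwise \<open>insert t Z\<close> is a cover with total slack 1 - x t < 1 in
    which no pair is a cover, and \<open>minimal_cover_prefix\<close> produces the tight case that
    is excluded.\<close>
  have Z_le: "sum a Z + a t \<le> b"
  proof (rule ccontr)
    assume "\<not> sum a Z + a t \<le> b"
    then have cov: "b < sum a (insert t Z)" using finZ \<open>t \<notin> Z\<close> by simp
    have tZ: "insert t Z \<subseteq> {..<n}" using Zn S(2) by simp
    have single: "a i \<le> b" if "i \<in> insert t Z" for i
      using that config_single_le[OF c, of t] by (auto simp: Z_def)
    have pair: "a i + a j \<le> b" if "i \<in> insert t Z" "j \<in> insert t Z" "i \<noteq> j" for i j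
      using that two_ones_le[of i j] by (auto simp: Z_def add.commute)
    have "(\<Sum>i\<in>Z. 1 - x i) = 0" by (intro sum.neutral) (auto simp: Z_def ones_def)
    then have slack: "(\<Sum>i\<in>insert t Z. 1 - x i) < 1" using xt finZ \<open>t \<notin> Z\<close> by simp
    obtain P where P: "b < sum a P" "\<And>t. t \<in> P \<Longrightarrow> violating (card P - 1) (P - {t}) t"
      using minimal_cover_prefix[OF tZ cov single pair slack] by blast
    have "P \<noteq> {}" "finite P" using P(1) by (auto intro: ccontr)
    then obtain u where u: "u \<in> P" by auto
    have "card (P - {u}) = card P - 1" using u \<open>finite P\<close> by simp
    then show False using P(2)[OF u] no_tight by metis
  qed
  \<comment> \<open>The conditions on subsets of sizes \<open>k\<close> and \<open>k - 1\<close> are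
    passed to their complements in \<open>S\<close>. Together, \<open>upper\<close> and
    \<open>lower\<close> say that any \<open>q\<close> elements of \<open>S\<close> weigh less than
    any \<open>q + 1\<close> elements.\<close>
  have upper: "b + sum a R < a t + sum a S" if R: "R \<subseteq> S" "card R = q" for R
  proof -
    have finR: "finite R" using R(1) finS by (rule finite_subset)
    have "card (S - R) = k" using R finR k by (simp add: card_Diff_subset q_def)
    then have "b < a t + sum a (S - R)" using c by (simp add: config_def)
    moreover have "sum a S = sum a (S - R) + sum a R" using R(1) finS by (rule sum.subset_diff)
    ultimately show ?thesis by simp
  qed
  have lower: "a t + sum a S \<le> b + sum a R" if R: "R \<subseteq> S" "card R = q + 1" for R
  proof -
    have finR: "finite R" using R(1) finS by (rule finite_subset)
    have "card (S - R) = k - 1" using R finR k by (simp add: card_Diff_subset q_def)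
    then have "a t + sum a (S - R) \<le> b" using c by (simp add: config_def)
    moreover have "sum a S = sum a (S - R) + sum a R" using R(1) finS by (rule sum.subset_diff)
    ultimately show ?thesis by simp
  qed
  have "inj_on key S" using inj_on_key S(1) by (rule inj_on_subset)
  moreover have "1 \<le> q + 1" "q + 1 \<le> card S" using kS k by (auto simp: q_def)
  ultimately obtain j where j: "j \<in> S" "card {i \<in> S. key i \<le> key j} = q + 1"
    using ex_card_le_threshold[OF finS] by blast
  define W where "W = {i \<in> S. key i \<le> key j}"
  have jn: "j < n" using j(1) S(1) by auto
  have cW: "card W = q + 1" using j(2) by (simp add: W_def)
  have W_sum: "sum a W \<le> (q + 1) * a j"
    using sum_bounded_above[of W a "a j"] key_le_imp_le[OF _ jn] cW by (auto simp: W_def)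
  \<comment> \<open>\<open>s\<close> extends to \<open>q\<close> elements of \<open>S\<close>; these
    weigh less than \<open>W\<close>, whose \<open>q + 1\<close> elements weigh at most
    \<open>a j\<close> each.\<close>
  have S_bound: "a s \<le> (q + 1) * a j" and aj: "0 < a j" if s: "s \<in> S" for s
  proof -
    have "1 \<le> q" "q \<le> card S" using kS by (auto simp: q_def)
    then obtain R where R: "{s} \<subseteq> R" "R \<subseteq> S" "card R = q"
      using exists_subset_between[of "{s}" q S] s finS by auto
    have "a s \<le> sum a R" using R finS by (intro member_le_sum) (auto intro: finite_subset)
    also have "sum a R < sum a W"
      using upper[OF R(2,3)] lower[OF _ cW] by (force simp: W_def)
    finally have "a s < (q + 1) * a j" using W_sum by linarith
    then show "a s \<le> (q + 1) * a j" "0 < a j" by (auto intro: ccontr)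
  qed
  define U where "U = {i \<in> base t j. i \<notin> S \<and> i \<noteq> t}"
  have UZ: "U \<subseteq> Z - S" by (auto simp: U_def base_def Z_def)
  have finU: "finite U" using UZ finZ by (auto intro: finite_subset)
  have "card U * a j \<le> sum a U"
  proof -
    have "a j \<le> a i" if "i \<in> U" for i
      using that by (intro key_le_imp_le) (auto simp: U_def base_def ones_def)
    then show ?thesis using sum_bounded_below[of U "a j" a] by simp
  qed
  also have "\<dots> \<le> sum a (Z - S)" using UZ finZ by (intro sum_mono2) auto
  \<comment> \<open>\<open>Z\<close> together with \<open>t\<close> fits into \<open>b\<close>,
    whereas \<open>S\<close> together with \<open>t\<close> exceeds \<open>b\<close>. Cancelling the
    common part \<open>S \<inter> ones\<close> leaves this comparison.\<close>
  also have "\<dots> < sum a (S \<inter> fracs)"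
  proof -
    have "Z - (S \<inter> ones) = Z - S" by (auto simp: Z_def)
    then have "sum a Z = sum a (Z - S) + sum a (S \<inter> ones)"
      using sum.subset_diff[OF SZ finZ, of a] by simp
    moreover obtain R where "R \<subseteq> S" "card R = q"
      using obtain_subset_with_card_n[of q S] by (auto simp: q_def)
    then have "b + sum a R < a t + sum a S" by (rule upper)
    ultimately show ?thesis using Z_le sumS by linarith
  qed
  also have "\<dots> \<le> f * ((q + 1) * a j)"
    using sum_bounded_above[of "S \<inter> fracs" a "(q + 1) * a j"] S_bound by (simp add: f_def)
  finally have "card U * a j < (f * (q + 1)) * a j" by (simp only: mult.assoc)
  then have "card U < f * (q + 1)" by (rule mult_less_cancel2[THEN iffD1, THEN conjunct2])
  also have "\<dots> \<le> card fracs * card fracs" using qf f_le by (intro mult_le_mono) linarith+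
  finally have cU: "card U \<le> card fracs * card fracs" by simp
  define X where "X = U \<union> (S \<inter> fracs \<union> W)"
  have "card X \<le> card U + (f + (q + 1))"
    using card_Un_le[of U "S \<inter> fracs \<union> W"] card_Un_le[of "S \<inter> fracs" W]
    unfolding X_def f_def cW[symmetric] by linarith
  also have "\<dots> \<le> card fracs * card fracs + 2 * card fracs" using cU qf f_le by linarith
  finally have cX: "card X \<le> card fracs * card fracs + 2 * card fracs" .
  have Xn: "X \<subseteq> {..<n}" using UZ Zn S(1) by (auto simp: X_def W_def)
  have "i \<in> S \<longleftrightarrow> i \<in> base t j" if i: "i < n" "i \<noteq> t" "i \<notin> X" for i
  proof
    assume iS: "i \<in> S"
    then have "i \<in> ones" using S_cases i(3) by (auto simp: X_def)
    moreover have "key j \<le> key i" using iS i(3) by (auto simp: X_def W_def)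
    ultimately show "i \<in> base t j" using config_pair_le[OF c iS] by (simp add: base_def)
  next
    assume "i \<in> base t j"
    then show "i \<in> S" using i by (auto simp: X_def U_def)
  qed
  then show ?thesis using jn v Xn finite_sub[OF Xn] cX by blast
qed

lemma violating_near_base:
  assumes "violating k0 S0 t0"
  shows "\<exists>k S t j X. j < n \<and> violating k S t \<and> finite X \<and>
           card X \<le> card fracs * card fracs + 2 * card fracs \<and> X \<subseteq> {..<n} \<and>
           (\<forall>i<n. i \<noteq> t \<longrightarrow> i \<notin> X \<longrightarrow> (i \<in> S \<longleftrightarrow> i \<in> base t j))"
proof (cases "\<exists>S t. violating (card S) S t")
  case True
  then obtain k S t j where "j < n \<and> violating k S t \<and>
           (\<forall>i<n. i \<noteq> t \<longrightarrow> i \<notin> fracs \<longrightarrow> (i \<in> S \<longleftrightarrow> i \<in> base t j))"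
    using tight_violating_near_base by blast
  \<comment> \<open>In the tight case, \<open>fracs\<close> itself serves as the exceptional
    set.\<close>
  moreover have "finite fracs" "fracs \<subseteq> {..<n}" by (auto simp: fracs_def)
  moreover have "card fracs \<le> card fracs * card fracs + 2 * card fracs" by simp
  ultimately show ?thesis by blast
next
  case False
  then show ?thesis using slack_violating_near_base[OF assms] by blast
qed

section \<open>Testing a candidate through two thresholds\<close>

text \<open>
  The guessed elements \<open>p\<close> and \<open>p'\<close> delimit the \<open>k\<close> lightest and the \<open>k - 1\<close> heaviest elements of \<open>S\<close>, which
  are the extreme cases of the two conditions on subsets in \<open>config\<close>.
\<close>

definition accepts :: "nat \<Rightarrow> nat \<Rightarrow> nat \<Rightarrow> nat set \<Rightarrow> bool" where
  "accepts p p' t S \<longleftrightarrow>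
     (let L = {i \<in> S. key i \<le> key p}; H = {i \<in> S. key p' \<le> key i} in
      2 \<le> card L \<and> card H + 1 = card L \<and> sum a S \<le> b \<and> b < a t + sum a L \<and> a t + sum a H \<le> b \<and>
      real (card S) < (real (card S) - real (card L) + 1) * x t + sum x S)"

text \<open>The elements of \<open>S\<close> up to \<open>p\<close> have the least weight among all
  subsets of \<open>S\<close> of their size, and those from \<open>p'\<close> on have the greatest.
  So the two tested sums bound the weights of all subsets over which \<open>config\<close>
  quantifies.\<close>

lemma accepts_imp_violating:
  assumes acc: "accepts p p' t S" and S: "S \<subseteq> {..<n}" "t < n" "t \<notin> S"
  shows "violating (card {i \<in> S. key i \<le> key p}) S t"
proof -
  define L where "L = {i \<in> S. key i \<le> key p}"
  define H where "H = {i \<in> S. key p' \<le> key i}"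
  have acc': "2 \<le> card L" "card H + 1 = card L" "sum a S \<le> b" "b < a t + sum a L"
    "a t + sum a H \<le> b" "real (card S) < (real (card S) - real (card L) + 1) * x t + sum x S"
    using acc by (auto simp: accepts_def L_def H_def Let_def)
  have finS: "finite S" using S(1) by (rule finite_sub)
  have LS: "L \<subseteq> S" and HS: "H \<subseteq> S" by (auto simp: L_def H_def)
  have low: "sum a L \<le> sum a Q" if "Q \<subseteq> S" "card Q = card L" for Q
  proof (rule sum_le_sum_exchange)
    fix i j assume "i \<in> L - Q" "j \<in> Q - L"
    then show "a i \<le> a j" using that S(1) by (intro key_le_imp_le) (auto simp: L_def)
  qed (use that LS finS in \<open>auto intro: finite_subset\<close>)
  have high: "sum a Q \<le> sum a H" if "Q \<subseteq> S" "card Q = card L - 1" for Q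
  proof (rule sum_le_sum_exchange)
    fix i j assume "i \<in> Q - H" "j \<in> H - Q"
    then show "a i \<le> a j" using that S(1) by (intro key_le_imp_le) (auto simp: H_def)
  qed (use that HS finS acc'(2) in \<open>auto intro: finite_subset\<close>)
  have "config (card L) S t"
    unfolding config_def
  proof (intro conjI allI impI)
    show "card L \<le> card S" using LS finS by (rule card_mono[rotated])
    show "b < a t + sum a Q" if "Q \<subseteq> S" "card Q = card L" for Q
      using low[OF that] acc'(4) by linarith
    show "a t + sum a Q \<le> b" if "Q \<subseteq> S" "card Q = card L - 1" for Q
      using high[OF that] acc'(5) by linarith
  qed (use S acc' in simp_all)
  then show ?thesis using acc'(6) by (simp add: violating_def L_def)
qed

text \<open>Keys are distinct on \<open>S\<close>, so there are thresholds that cut off exactly the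
  \<open>k\<close> lightest and the \<open>k - 1\<close> heaviest elements.\<close>

lemma violating_imp_accepts:
  assumes v: "violating k S t"
  obtains p p' where "p < n" "p' < n" "accepts p p' t S"
proof -
  have c: "config k S t" using v by (simp add: violating_def)
  have S: "S \<subseteq> {..<n}" and k: "2 \<le> k" "k \<le> card S" using c by (auto simp: config_def)
  have finS: "finite S" using S by (rule finite_sub)
  have inj: "inj_on key S" using inj_on_key S by (rule inj_on_subset)
  obtain p where p: "p \<in> S" "card {i \<in> S. key i \<le> key p} = k"
    using ex_card_le_threshold[OF finS inj, of k] k by auto
  have "1 \<le> k - 1" "k - 1 \<le> card S" using k by linarith+
  then obtain p' where p': "p' \<in> S" "card {i \<in> S. key p' \<le> key i} = k - 1"
    using ex_card_ge_threshold[OF finS inj] by blast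
  have L: "{i \<in> S. key i \<le> key p} \<subseteq> S" and H: "{i \<in> S. key p' \<le> key i} \<subseteq> S" by auto
  have "b < a t + sum a {i \<in> S. key i \<le> key p}" "a t + sum a {i \<in> S. key p' \<le> key i} \<le> b"
    "sum a S \<le> b"
    using c p(2) p'(2) L H unfolding config_def by blast+
  then have "accepts p p' t S"
    using v p p' k by (simp add: accepts_def violating_def Let_def)
  then show thesis using that p(1) p'(1) S by auto
qed

end

section \<open>Bounded stores and running times\<close>

lemma less_two_power_bit_length: "k < 2 ^ bit_length k"
proof (cases "k = 0")
  case False
  then show ?thesis using floor_log_exp2_gt[of k] by (simp add: bit_length_def)
qed (simp add: bit_length_def)

lemma bit_length_le:
  assumes "k < 2 ^ u" "1 \<le> u"
  shows "bit_length k \<le> u"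
proof (cases "k = 0")
  case True
  then show ?thesis using assms by (simp add: bit_length_def floor_log.simps)
next
  case False
  then have "2 ^ floor_log k \<le> k" using floor_log_exp2_le[of k] by simp
  then have "(2::nat) ^ floor_log k < 2 ^ u" using assms(1) by linarith
  then show ?thesis by (simp add: bit_length_def)
qed

definition bounded :: "nat \<Rightarrow> store \<Rightarrow> bool" where
  "bounded L s \<longleftrightarrow> (\<forall>r i. s r i < 2 ^ L)"

lemma bounded_update: "bounded L s \<Longrightarrow> v < 2 ^ L \<Longrightarrow> bounded L (s(r := (s r)(i := v)))"
  by (simp add: bounded_def)

text \<open>
  If all cells are less than \<open>2\<^sup>L\<close>, then an expression of width \<open>c\<close> has a value less than \<open>2\<close> to the power
  \<open>c * L\<close>. So it is enough to bound the contents of the cells; all costs are then multiples of \<open>L\<close>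
  with factors that depend on the program only.
\<close>

fun width :: "expr \<Rightarrow> nat" where
  "width (Num k) = bit_length k"
| "width (Cell r e) = 1"
| "width (Add e f) = width e + width f"
| "width (Sub e f) = width e"
| "width (Mul e f) = width e + width f"
| "width (Div e f) = width e"

text \<open>The cost of an expression in units of \<open>L\<close>: each node pays for a value of at
  most \<open>width\<close> times \<open>L\<close> bits.\<close>

fun weight :: "expr \<Rightarrow> nat" where
  "weight (Num k) = bit_length k"
| "weight (Cell r e) = weight e + 1"
| "weight (Add e f) = weight e + weight f + width (Add e f)"
| "weight (Sub e f) = weight e + weight f + width (Sub e f)"
| "weight (Mul e f) = weight e + weight f + width (Mul e f)"
| "weight (Div e f) = weight e + weight f + width (Div e f)"

text \<open>Both branches of a conditional are counted, so that the factor depends on the program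
  text only. A loop is counted with a single pass; its repetitions go into the unit of time.\<close>

fun prog_weight :: "prog \<Rightarrow> nat" where
  "prog_weight Skip = 1"
| "prog_weight (Assign r e f) = 1 + weight e + weight f"
| "prog_weight (Seq p q) = prog_weight p + prog_weight q"
| "prog_weight (Cond e p q) = 1 + weight e + prog_weight p + prog_weight q"
| "prog_weight (While e p) = 1 + weight e + prog_weight p"

lemma width_pos: "1 \<le> width e"
  by (induction e) (auto simp: bit_length_def)

lemma val_less:
  assumes "bounded L s" "1 \<le> L"
  shows "val s e < 2 ^ (width e * L)"
proof (induction e)
  case (Num k)
  have "(2::nat) ^ bit_length k \<le> 2 ^ (bit_length k * L)"
    using assms(2) by (intro power_increasing) auto
  with less_two_power_bit_length[of k] have "k < 2 ^ (bit_length k * L)" by (rule less_le_trans)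
  then show ?case by simp
next
  case (Cell r e)
  then show ?case using assms(1) by (simp add: bounded_def)
next
  case (Add e f)
  let ?u = "width e * L" and ?v = "width f * L"
  \<comment> \<open>Both powers are at least 2, so a sum of two numbers below them is less than
    their product.\<close>
  have "1 * 1 \<le> ?u" "1 * 1 \<le> ?v" using width_pos assms(2) by (intro mult_le_mono; simp)+
  then have "(2::nat) ^ 1 \<le> 2 ^ ?u" "(2::nat) ^ 1 \<le> 2 ^ ?v" by (intro power_increasing; simp)+
  then obtain p q :: nat where pq: "2 ^ ?u = p + 2" "2 ^ ?v = q + 2"
    by (metis le_add_diff_inverse2 power_one_right)
  have "val s e + val s f < 2 ^ ?u * 2 ^ ?v" using Add pq by (simp add: algebra_simps)
  then show ?case by (simp add: add_mult_distrib power_add)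
next
  case (Mul e f)
  then have "val s e * val s f < 2 ^ (width e * L) * 2 ^ (width f * L)"
    by (intro mult_strict_mono) auto
  then show ?case by (simp add: add_mult_distrib power_add)
next
  case (Sub e f)
  then show ?case by simp
next
  case (Div e f)
  have "val s (Div e f) \<le> val s e" by simp
  also have "\<dots> < 2 ^ (width e * L)" by (rule Div(1))
  finally show ?case by simp
qed

lemma bit_length_val_le:
  assumes "bounded L s" "1 \<le> L"
  shows "bit_length (val s e) \<le> width e * L"
proof (rule bit_length_le[OF val_less[OF assms]])
  have "1 * 1 \<le> width e * L" by (intro mult_le_mono width_pos assms(2))
  then show "1 \<le> width e * L" by simp
qed

lemma expr_cost_le:
  assumes "bounded L s" "1 \<le> L"
  shows "expr_cost s e \<le> weight e * L"
proof (induction e)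
  case (Num k)
  show ?case using assms(2) by simp
next
  case (Cell r e)
  then show ?case using bit_length_val_le[OF assms, of "Cell r e"] by simp
next
  case (Add e f)
  then show ?case using bit_length_val_le[OF assms, of "Add e f"] by (simp add: add_mult_distrib)
next
  case (Sub e f)
  then show ?case using bit_length_val_le[OF assms, of "Sub e f"] by (simp add: add_mult_distrib)
next
  case (Mul e f)
  then show ?case using bit_length_val_le[OF assms, of "Mul e f"] by (simp add: add_mult_distrib)
next
  case (Div e f)
  then show ?case using bit_length_val_le[OF assms, of "Div e f"] by (simp add: add_mult_distrib)
qed

section \<open>Running times of the control structures\<close>

text \<open>
  The time is counted in units of \<open>X\<close> per node of the program: \<open>X = L\<close> for loop-free programs, and
  every loop multiplies \<open>X\<close> by the number of its tests.
\<close>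

definition reaches :: "nat \<Rightarrow> nat \<Rightarrow> prog \<Rightarrow> store \<Rightarrow> (store \<Rightarrow> bool) \<Rightarrow> bool" where
  "reaches L X p s Q \<longleftrightarrow>
     (\<exists>t s'. exec p s t s' \<and> t \<le> prog_weight p * X \<and> bounded L s' \<and> Q s')"

lemma reaches_mono:
  assumes "reaches L X p s Q" "X \<le> Y" "\<And>s'. bounded L s' \<Longrightarrow> Q s' \<Longrightarrow> Q' s'"
  shows "reaches L Y p s Q'"
  using assms unfolding reaches_def by (meson le_trans mult_le_mono2)

lemma reaches_Skip:
  assumes "bounded L s" "1 \<le> X" "Q s"
  shows "reaches L X Skip s Q"
  using assms exec.Skip[of s] unfolding reaches_def by (intro exI[of _ 1] exI[of _ s]) simp

lemma reaches_Assign: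
  assumes "bounded L s" "1 \<le> L" "L \<le> X" "val s f < 2 ^ L"
    "bounded L (s(r := (s r)(val s e := val s f))) \<Longrightarrow> Q (s(r := (s r)(val s e := val s f)))"
  shows "reaches L X (Assign r e f) s Q"
proof -
  have "expr_cost s e \<le> weight e * X" "expr_cost s f \<le> weight f * X"
    using expr_cost_le[OF assms(1,2)] assms(3) by (meson le_trans mult_le_mono2)+
  then have "1 + expr_cost s e + expr_cost s f \<le> prog_weight (Assign r e f) * X"
    using assms(2,3) by (simp add: add_mult_distrib)
  then show ?thesis
    using exec.Assign[of r e f s] bounded_update[OF assms(1,4)] assms(5) unfolding reaches_def by blast
qed

lemma reaches_Seq:
  assumes "reaches L X p s R" "\<And>s'. bounded L s' \<Longrightarrow> R s' \<Longrightarrow> reaches L X q s' Q"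
  shows "reaches L X (Seq p q) s Q"
proof -
  obtain t s' where 1: "exec p s t s'" "t \<le> prog_weight p * X" "bounded L s'" "R s'"
    using assms(1) unfolding reaches_def by blast
  obtain t' s'' where 2: "exec q s' t' s''" "t' \<le> prog_weight q * X" "bounded L s''" "Q s''"
    using assms(2)[OF 1(3,4)] unfolding reaches_def by blast
  have "t + t' \<le> prog_weight (Seq p q) * X" using 1(2) 2(2) by (simp add: add_mult_distrib)
  then show ?thesis using exec.Seq[OF 1(1) 2(1)] 2(3,4) unfolding reaches_def by blast
qed

lemma reaches_Cond:
  assumes "bounded L s" "1 \<le> L" "L \<le> X"
    "val s e \<noteq> 0 \<Longrightarrow> reaches L X p s Q" "val s e = 0 \<Longrightarrow> reaches L X q s Q"
  shows "reaches L X (Cond e p q) s Q"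
proof -
  have c: "1 + expr_cost s e \<le> (1 + weight e) * X"
  proof -
    have "expr_cost s e \<le> weight e * X"
      using expr_cost_le[OF assms(1,2)] assms(3) by (meson le_trans mult_le_mono2)
    then show ?thesis using assms(2,3) by (simp add: add_mult_distrib)
  qed
  show ?thesis
  proof (cases "val s e = 0")
    case False
    then obtain t s' where 1: "exec p s t s'" "t \<le> prog_weight p * X" "bounded L s'" "Q s'"
      using assms(4) unfolding reaches_def by blast
    have "1 + expr_cost s e + t \<le> prog_weight (Cond e p q) * X"
      using c 1(2) by (simp add: add_mult_distrib)
    then show ?thesis using exec.CondTrue[OF False 1(1)] 1(3,4) unfolding reaches_def by blast
  next
    case True
    then obtain t s' where 1: "exec q s t s'" "t \<le> prog_weight q * X" "bounded L s'" "Q s'"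
      using assms(5) unfolding reaches_def by blast
    have "1 + expr_cost s e + t \<le> prog_weight (Cond e p q) * X"
      using c 1(2) by (simp add: add_mult_distrib)
    then show ?thesis using exec.CondFalse[OF True 1(1)] 1(3,4) unfolding reaches_def by blast
  qed
qed

text \<open>The invariant is indexed by the number of completed iterations, which determines when
  the loop ends. There are \<open>n\<close> iterations and \<open>Suc n\<close> tests; charging the
  weight of the whole loop for each test gives the factor \<open>Suc n\<close>.\<close>

lemma reaches_While:
  assumes L: "1 \<le> L" "L \<le> X"
    and "bounded L s" "I 0 s"
    and step: "\<And>i s. i < n \<Longrightarrow> bounded L s \<Longrightarrow> I i s \<Longrightarrow>
      val s e \<noteq> 0 \<and> reaches L X p s (I (Suc i))"
    and exit: "\<And>s. bounded L s \<Longrightarrow> I n s \<Longrightarrow> val s e = 0"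
  shows "reaches L (Suc n * X) (While e p) s (I n)"
proof -
  let ?w = "prog_weight (While e p)"
  have test: "1 + expr_cost s e \<le> (1 + weight e) * X" if "bounded L s" for s
  proof -
    have "expr_cost s e \<le> weight e * X"
      using expr_cost_le[OF that L(1)] L(2) by (meson le_trans mult_le_mono2)
    then show ?thesis using L by (simp add: add_mult_distrib)
  qed
  \<comment> \<open>Induction on the number \<open>k\<close> of iterations still to come.\<close>
  have "\<exists>t s'. exec (While e p) s t s' \<and> t \<le> Suc k * (?w * X) \<and> bounded L s' \<and> I n s'"
    if "k \<le> n" "bounded L s" "I (n - k) s" for k s
    using that
  proof (induction k arbitrary: s)
    case 0
    then have "val s e = 0" using exit by simp
    moreover have "1 + expr_cost s e \<le> Suc 0 * (?w * X)"
      using test[OF 0(2)] by (simp add: add_mult_distrib)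
    ultimately show ?case using exec.WhileFalse 0 by (metis diff_zero)
  next
    case (Suc k)
    have k: "n - Suc k < n" "Suc (n - Suc k) = n - k" using Suc.prems(1) by simp_all
    have v: "val s e \<noteq> 0" and r: "reaches L X p s (I (n - k))"
      using step[OF k(1) Suc.prems(2,3)] k(2) by simp_all
    obtain t s' where 1: "exec p s t s'" "t \<le> prog_weight p * X" "bounded L s'" "I (n - k) s'"
      using r unfolding reaches_def by blast
    obtain t' s'' where 2: "exec (While e p) s' t' s''" "t' \<le> Suc k * (?w * X)" "bounded L s''" "I n s''"
      using Suc.IH[OF _ 1(3,4)] Suc.prems(1) by auto
    have "1 + expr_cost s e + t + t' \<le> Suc (Suc k) * (?w * X)"
      using test[OF Suc.prems(2)] 1(2) 2(2) by (simp add: add_mult_distrib)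
    then show ?case using exec.WhileTrue[OF v 1(1) 2(1)] 2(3,4) by blast
  qed
  then obtain t s' where "exec (While e p) s t s'" "t \<le> Suc n * (?w * X)" "bounded L s'" "I n s'"
    using assms(3,4) by (metis diff_self_eq_0 order_refl)
  then show ?thesis unfolding reaches_def by (metis mult.left_commute)
qed

section \<open>Counting loops\<close>

text \<open>The counter is always cell \<open>0\<close> of array \<open>3\<close>, so these loops
  follow one another but are never nested. The loop over all candidates is a plain
  \<open>While\<close> with a counter of its own.\<close>

definition for_loop :: "expr \<Rightarrow> prog \<Rightarrow> prog" where
  "for_loop N p = Seq (Assign 3 (Num 0) (Num 0))
     (While (Sub N (Cell 3 (Num 0))) (Seq p (Assign 3 (Num 0) (Add (Cell 3 (Num 0)) (Num 1)))))"

text \<open>The body must leave the counter at \<open>i\<close>, and the invariant for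
  \<open>Suc i\<close> is claimed only for the store in which the counter has been advanced.\<close>

lemma reaches_for_loop:
  assumes L: "1 \<le> L" "L \<le> X" and n: "n < 2 ^ L"
    and b: "bounded L s" and init: "I 0 (s(3 := (s 3)(0 := 0)))"
    and counter: "\<And>i s. i \<le> n \<Longrightarrow> I i s \<Longrightarrow> s 3 0 = i \<and> val s N = n"
    and step: "\<And>i s. i < n \<Longrightarrow> bounded L s \<Longrightarrow> I i s \<Longrightarrow>
      reaches L X p s (\<lambda>s'. s' 3 0 = i \<and> I (Suc i) (s'(3 := (s' 3)(0 := Suc i))))"
  shows "reaches L (Suc n * X) (for_loop N p) s (I n)"
  unfolding for_loop_def
proof (rule reaches_Seq)
  show "reaches L (Suc n * X) (Assign 3 (Num 0) (Num 0)) s (I 0)"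
    using L b init by (intro reaches_Assign) auto
next
  fix s' assume s': "bounded L s'" "I 0 s'"
  show "reaches L (Suc n * X) (While (Sub N (Cell 3 (Num 0)))
      (Seq p (Assign 3 (Num 0) (Add (Cell 3 (Num 0)) (Num 1))))) s' (I n)"
  proof (rule reaches_While[where I = I and n = n, OF L s'])
    fix i s assume i: "i < n" "bounded L s" "I i s"
    have "reaches L X (Seq p (Assign 3 (Num 0) (Add (Cell 3 (Num 0)) (Num 1)))) s (I (Suc i))"
    proof (rule reaches_Seq[OF step[OF i]])
      fix s' assume s': "bounded L s'" "s' 3 0 = i \<and> I (Suc i) (s'(3 := (s' 3)(0 := Suc i)))"
      then show "reaches L X (Assign 3 (Num 0) (Add (Cell 3 (Num 0)) (Num 1))) s' (I (Suc i))"
        using L n i(1) by (intro reaches_Assign) auto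
    qed
    then show "val s (Sub N (Cell 3 (Num 0))) \<noteq> 0 \<and>
        reaches L X (Seq p (Assign 3 (Num 0) (Add (Cell 3 (Num 0)) (Num 1)))) s (I (Suc i))"
      using counter[of i s] i by simp
  next
    fix s assume "bounded L s" "I n s"
    then show "val s (Sub N (Cell 3 (Num 0))) = 0" using counter[of n s] by simp
  qed
qed

definition sum_loop :: "expr \<Rightarrow> nat \<Rightarrow> expr \<Rightarrow> prog" where
  "sum_loop N d e = Seq (Assign 3 (Num d) (Num 0))
     (for_loop N (Assign 3 (Num d) (Add (Cell 3 (Num d)) e)))"

lemma reaches_sum_loop:
  assumes L: "1 \<le> L" "L \<le> X" "n < 2 ^ L" "bounded L s" and d: "d \<noteq> 0"
    and N: "\<And>u i. val (s(3 := (s 3)(d := u, 0 := i))) N = n"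
    and e: "\<And>u i. i < n \<Longrightarrow> val (s(3 := (s 3)(d := u, 0 := i))) e = g i"
    and g: "sum g {..<n} < 2 ^ L"
    and Q: "Q (s(3 := (s 3)(d := sum g {..<n}, 0 := n)))"
  shows "reaches L (Suc n * X) (sum_loop N d e) s Q"
  unfolding sum_loop_def
proof (rule reaches_Seq)
  show "reaches L (Suc n * X) (Assign 3 (Num d) (Num 0)) s (\<lambda>s'. s' = s(3 := (s 3)(d := 0)))"
    using L by (intro reaches_Assign) auto
next
  fix s' assume s': "bounded L s'" "s' = s(3 := (s 3)(d := 0))"
  define I where "I i s' \<longleftrightarrow> s' = s(3 := (s 3)(d := sum g {..<i}, 0 := i))" for i s'
  have "reaches L (Suc n * X) (for_loop N (Assign 3 (Num d) (Add (Cell 3 (Num d)) e))) s' (I n)"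
  proof (rule reaches_for_loop[where I = I and n = n, OF L(1,2,3) s'(1)])
    show "I 0 (s'(3 := (s' 3)(0 := 0)))" by (simp add: I_def s'(2))
  next
    fix i s'' assume "I i s''"
    then show "s'' 3 0 = i \<and> val s'' N = n" using N by (simp add: I_def)
  next
    fix i s'' assume i: "i < n" "bounded L s''" "I i s''"
    \<comment> \<open>Partial sums do not exceed the total, so a bound on the total suffices for the
      accumulator.\<close>
    have "sum g {..<i} + g i = sum g {..<Suc i}" by simp
    also have "\<dots> \<le> sum g {..<n}" using i(1) by (intro sum_mono2) auto
    finally have le: "sum g {..<i} + g i < 2 ^ L" using g by simp
    have "val s'' e = g i" using e[OF i(1)] i(3) by (simp add: I_def)
    moreover have "s'' 3 d = sum g {..<i}" "s'' 3 0 = i" using i(3) d by (simp_all add: I_def)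
    moreover have "s''(3 := (s'' 3)(d := sum g {..<i} + g i, 0 := Suc i)) =
        s(3 := (s 3)(d := sum g {..<Suc i}, 0 := Suc i))"
      using i(3) d by (auto simp: I_def fun_eq_iff)
    ultimately show "reaches L X (Assign 3 (Num d) (Add (Cell 3 (Num d)) e)) s''
        (\<lambda>s'. s' 3 0 = i \<and> I (Suc i) (s'(3 := (s' 3)(0 := Suc i))))"
      using L le i(2) d by (intro reaches_Assign) (auto simp: I_def)
  qed
  then show "reaches L (Suc n * X) (for_loop N (Assign 3 (Num d) (Add (Cell 3 (Num d)) e))) s' Q"
    using Q by (auto simp: I_def intro: reaches_mono)
qed

definition fill_loop :: "expr \<Rightarrow> nat \<Rightarrow> expr \<Rightarrow> expr \<Rightarrow> prog" where
  "fill_loop N r k e = for_loop N (Assign r (Add k (Cell 3 (Num 0))) e)"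

lemma reaches_fill_loop:
  assumes L: "1 \<le> L" "L \<le> X" "n < 2 ^ L" "bounded L s" and r: "r \<noteq> 3"
    and N: "\<And>u i. val (s(r := u, 3 := (s 3)(0 := i))) N = n"
    and k: "\<And>u i. val (s(r := u, 3 := (s 3)(0 := i))) k = c"
    and e: "\<And>u i. i < n \<Longrightarrow> val (s(r := u, 3 := (s 3)(0 := i))) e = g i"
    and g: "\<And>i. i < n \<Longrightarrow> g i < 2 ^ L"
    and Q: "Q (s(r := (\<lambda>j. if c \<le> j \<and> j < c + n then g (j - c) else s r j), 3 := (s 3)(0 := n)))"
  shows "reaches L (Suc n * X) (fill_loop N r k e) s Q"
proof -
  define f where "f i = (\<lambda>j. if c \<le> j \<and> j < c + i then g (j - c) else s r j)" for i
  define I where "I i s' \<longleftrightarrow> s' = s(r := f i, 3 := (s 3)(0 := i))" for i s'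
  have "reaches L (Suc n * X) (fill_loop N r k e) s (I n)"
    unfolding fill_loop_def
  proof (rule reaches_for_loop[where I = I and n = n, OF L])
    have "f 0 = s r" by (auto simp: f_def)
    then show "I 0 (s(3 := (s 3)(0 := 0)))" using r by (simp add: I_def fun_eq_iff)
  next
    fix i s'' assume "I i s''"
    then show "s'' 3 0 = i \<and> val s'' N = n" using N by (simp add: I_def)
  next
    fix i s'' assume i: "i < n" "bounded L s''" "I i s''"
    have v: "val s'' e = g i" "val s'' k = c" "s'' 3 0 = i" using e[OF i(1)] k i(3) by (simp_all add: I_def)
    have upd: "f (Suc i) = (f i)(c + i := g i)" by (auto simp: f_def fun_eq_iff)
    then have "s''(r := (s'' r)(c + i := g i), 3 := (s'' 3)(0 := Suc i)) =
        s(r := f (Suc i), 3 := (s 3)(0 := Suc i))"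
      using i(3) r unfolding upd by (simp add: I_def fun_eq_iff)
    then show "reaches L X (Assign r (Add k (Cell 3 (Num 0))) e) s''
        (\<lambda>s'. s' 3 0 = i \<and> I (Suc i) (s'(3 := (s' 3)(0 := Suc i))))"
      using L g[OF i(1)] i(2) r v by (intro reaches_Assign) (auto simp: I_def)
  qed
  then show ?thesis using Q by (auto simp: I_def f_def intro: reaches_mono)
qed

section \<open>The separation program\<close>

abbreviation var :: "nat \<Rightarrow> expr" where
  "var c \<equiv> Cell 3 (Num c)"

text \<open>Comparisons become 0/1 values through truncated subtraction: the difference vanishes
  exactly if the first value is at most the second. Products of such values act as
  conjunctions.\<close>

definition leE :: "expr \<Rightarrow> expr \<Rightarrow> expr" where
  "leE e f = Sub (Num 1) (Sub e f)"

definition lessE :: "expr \<Rightarrow> expr \<Rightarrow> expr" where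
  "lessE e f = leE (Add e (Num 1)) f"

definition eqE :: "expr \<Rightarrow> expr \<Rightarrow> expr" where
  "eqE e f = Mul (leE e f) (leE f e)"

definition modE :: "expr \<Rightarrow> expr \<Rightarrow> expr" where
  "modE e f = Sub e (Mul (Div e f) f)"

fun powE :: "expr \<Rightarrow> nat \<Rightarrow> expr" where
  "powE e 0 = Num 1"
| "powE e (Suc k) = Mul e (powE e k)"

lemma val_leE [simp]: "val s (leE e f) = of_bool (val s e \<le> val s f)"
  by (auto simp: leE_def)

lemma val_lessE [simp]: "val s (lessE e f) = of_bool (val s e < val s f)"
  by (auto simp: lessE_def)

lemma val_eqE [simp]: "val s (eqE e f) = of_bool (val s e = val s f)"
  by (auto simp: eqE_def)

lemma val_modE [simp]: "val s (modE e f) = val s e mod val s f"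
  by (simp add: modE_def minus_div_mult_eq_mod)

lemma val_powE [simp]: "val s (powE e k) = val s e ^ k"
  by (induction k) auto

text \<open>
  Array \<open>2\<close> holds the characteristic function of the candidate \<open>S\<close>. The cells of array \<open>3\<close> are
  variables: \<open>0\<close> is the loop counter, \<open>1\<close> a common denominator of the solution, \<open>2\<close> the number of
  candidates, \<open>3\<close> the number of the current one, \<open>4\<close> what remains of it to be decoded,
  \<open>5\<close> to \<open>9\<close> are the row, \<open>t\<close>, \<open>j\<close>, \<open>p\<close> and \<open>p'\<close>, and \<open>10\<close> to \<open>16\<close> the sums needed for the test.
\<close>

definition mE :: expr where "mE = Cell 0 (Num 1)"

definition nE :: expr where "nE = Cell 0 (Num 2)"

text \<open>Cell \<open>0\<close> of the input array holds the length of the list and cells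
  \<open>1\<close> and \<open>2\<close> the dimensions, so the matrix starts at cell
  \<open>3\<close>.\<close>

definition entryE :: "expr \<Rightarrow> expr" where
  "entryE e = Cell 0 (Add (Num 3) (Add (Mul (var 5) nE) e))"

definition rhsE :: expr where
  "rhsE = Cell 0 (Add (Num 3) (Add (Mul mE nE) (var 5)))"

text \<open>The offset passes over the matrix, the right-hand side and the objective; the
  denominators start \<open>n\<close> cells later.\<close>

definition numE :: "expr \<Rightarrow> expr" where
  "numE e = Cell 0 (Add (Num 3) (Add (Add (Mul mE nE) (Add mE nE)) e))"

definition denE :: "expr \<Rightarrow> expr" where
  "denE e = Cell 0 (Add (Num 3) (Add (Add (Mul mE nE) (Add mE (Mul (Num 2) nE))) e))"

definition keyE :: "expr \<Rightarrow> expr" where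
  "keyE e = Add (Mul (entryE e) nE) e"

text \<open>The solution value times the common denominator. The division is exact, so the test for
  violation needs integer arithmetic only.\<close>

definition scaledE :: "expr \<Rightarrow> expr" where
  "scaledE e = Div (Mul (numE e) (var 1)) (denE e)"

text \<open>Membership of the loop index in \<open>base t j\<close>; the value 1 is recognised by
  equal numerator and denominator.\<close>

definition baseE :: expr where
  "baseE = Mul (eqE (numE (var 0)) (denE (var 0)))
     (Mul (leE (keyE (var 7)) (keyE (var 0))) (leE (Add (entryE (var 0)) (entryE (var 6))) rhsE))"

definition selE :: expr where "selE = Cell 2 (var 0)"

section \<open>Candidates as mixed-radix numbers\<close>

definition decode :: "nat \<Rightarrow> expr \<Rightarrow> prog" where
  "decode c e = Seq (Assign 3 (Num c) (modE (var 4) e)) (Assign 3 (Num 4) (Div (var 4) e))"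

text \<open>A digit \<open>2 * v + c\<close> in base \<open>2 * n\<close> stands for setting cell \<open>v\<close> to \<open>c\<close>.\<close>

fun edits :: "nat \<Rightarrow> prog" where
  "edits 0 = Skip"
| "edits (Suc w) = Seq (Seq
     (Assign 2 (Div (modE (var 4) (Mul (Num 2) nE)) (Num 2)) (modE (modE (var 4) (Mul (Num 2) nE)) (Num 2)))
     (Assign 3 (Num 4) (Div (var 4) (Mul (Num 2) nE)))) (edits w)"

text \<open>The effect of \<open>edits\<close> on array \<open>2\<close>, as a function of the code
  \<open>y\<close> held in variable \<open>4\<close>.\<close>

fun edit :: "nat \<Rightarrow> nat \<Rightarrow> nat \<Rightarrow> (nat \<Rightarrow> nat) \<Rightarrow> nat \<Rightarrow> nat" where
  "edit n 0 y h = h"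
| "edit n (Suc w) y h = edit n w (y div (2 * n)) (h(y mod (2 * n) div 2 := y mod (2 * n) mod 2))"

text \<open>The lowest digits of the candidate number are the row, \<open>t\<close>,
  \<open>j\<close>, \<open>p\<close> and \<open>p'\<close>; the rest encodes the edits of the base
  set. Finally \<open>t\<close> is erased, since the base set may contain it.\<close>

definition prepare :: "nat \<Rightarrow> prog" where
  "prepare w = Seq (Assign 3 (Num 4) (var 3)) (Seq (decode 5 mE) (Seq (decode 6 nE) (Seq (decode 7 nE)
     (Seq (decode 8 nE) (Seq (decode 9 nE) (Seq (fill_loop nE 2 (Num 0) baseE) (Seq (edits w)
     (Assign 2 (var 6) (Num 0)))))))))"

fun sum_loops :: "nat \<Rightarrow> expr list \<Rightarrow> prog" where
  "sum_loops c [] = Skip"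
| "sum_loops c (e # es) = Seq (sum_loop nE c e) (sum_loops (Suc c) es)"

text \<open>In this order: size and weight of the candidate, the numbers of its elements up to
  \<open>p\<close> and from \<open>p'\<close> on, the weights of these two parts, and the scaled
  value of the candidate.\<close>

definition evaluate :: prog where
  "evaluate = sum_loops 10
     [selE,
      Mul selE (entryE (var 0)),
      Mul selE (leE (keyE (var 0)) (keyE (var 8))),
      Mul selE (leE (keyE (var 9)) (keyE (var 0))),
      Mul selE (Mul (leE (keyE (var 0)) (keyE (var 8))) (entryE (var 0))),
      Mul selE (Mul (leE (keyE (var 9)) (keyE (var 0))) (entryE (var 0))),
      Mul selE (scaledE (var 0))]"

text \<open>The conditions of \<open>accepts\<close>, with the last one multiplied by the common
  denominator. Variable \<open>12\<close> plays the role of \<open>k\<close>; it counts a part of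
  the candidate, so the subtraction from \<open>card S + 1\<close> is not truncated.\<close>

definition checkE :: expr where
  "checkE = Mul (leE (Num 2) (var 12)) (Mul (eqE (Add (var 13) (Num 1)) (var 12))
     (Mul (leE (var 11) rhsE) (Mul (lessE rhsE (Add (entryE (var 6)) (var 14)))
     (Mul (leE (Add (entryE (var 6)) (var 15)) rhsE)
     (lessE (Mul (var 10) (var 1))
       (Add (Mul (Sub (Add (var 10) (Num 1)) (var 12)) (scaledE (var 6))) (var 16)))))))"

text \<open>The same set is written twice, as the answer uses \<open>N = S\<close>.\<close>

definition output_prog :: prog where
  "output_prog = Seq (Assign 1 (Num 0) (Add (Num 3) (Mul (Num 2) nE))) (Seq (Assign 1 (Num 1) (var 5))
     (Seq (Assign 1 (Num 2) (var 12)) (Seq (Assign 1 (Num 3) (var 6))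
     (Seq (fill_loop nE 1 (Num 4) selE) (fill_loop nE 1 (Add (Num 4) nE) selE)))))"

text \<open>There is no early exit: a later success overwrites the output of an earlier one.\<close>

definition body :: "nat \<Rightarrow> prog" where
  "body w = Seq (prepare w) (Seq evaluate (Seq (Cond checkE output_prog Skip)
     (Assign 3 (Num 3) (Add (var 3) (Num 1)))))"

text \<open>The number of candidates is the product of the radices: \<open>m\<close> for the row,
  \<open>n\<close> for each of \<open>t\<close>, \<open>j\<close>, \<open>p\<close> and
  \<open>p'\<close>, and \<open>2 * n\<close> for each of the \<open>w\<close> edits.\<close>

definition init :: "nat \<Rightarrow> prog" where
  "init w = Seq (Assign 3 (Num 1) (Num 1)) (Seq (for_loop nE (Assign 3 (Num 1) (Mul (var 1) (denE (var 0)))))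
     (Assign 3 (Num 2) (Mul mE (Mul (powE nE 4) (powE (Mul (Num 2) nE) w)))))"

definition separator :: "nat \<Rightarrow> prog" where
  "separator w = Seq (init w) (While (Sub (var 2) (var 3)) (body w))"

section \<open>Effects of decoding and editing\<close>

lemma reaches_decode:
  assumes L: "1 \<le> L" "L \<le> X" "bounded L s" and c: "c \<noteq> 4"
    and e: "\<And>u. val (s(3 := u)) e = v"
    and Q: "Q (s(3 := (s 3)(c := s 3 4 mod v, 4 := s 3 4 div v)))"
  shows "reaches L X (decode c e) s Q"
  unfolding decode_def
proof (rule reaches_Seq)
  have v: "val s e = v" using e[of "s 3"] by simp
  have lt: "s 3 4 < 2 ^ L" using L(3) by (simp add: bounded_def)
  have "s 3 4 mod v < 2 ^ L" using mod_less_eq_dividend lt by (rule le_less_trans)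
  then show "reaches L X (Assign 3 (Num c) (modE (var 4) e)) s (\<lambda>s'. s' = s(3 := (s 3)(c := s 3 4 mod v)))"
    using L v by (intro reaches_Assign) auto
  fix s' assume s': "bounded L s'" "s' = s(3 := (s 3)(c := s 3 4 mod v))"
  have "s 3 4 div v < 2 ^ L" using div_le_dividend lt by (rule le_less_trans)
  then show "reaches L X (Assign 3 (Num 4) (Div (var 4) e)) s' Q"
    using L s' c e Q by (intro reaches_Assign) auto
qed

lemma reaches_edits:
  assumes L: "1 \<le> L" "L \<le> X" "bounded L s" and n: "s 0 2 = n"
    and Q: "Q (s(2 := edit n w (s 3 4) (s 2), 3 := (s 3)(4 := s 3 4 div (2 * n) ^ w)))"
  shows "reaches L X (edits w) s Q"
  using L n Q
proof (induction w arbitrary: s)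
  case 0
  then show ?case by (auto intro!: reaches_Skip)
next
  case (Suc w)
  let ?y = "s 3 4"
  let ?h = "(s 2)(?y mod (2 * n) div 2 := ?y mod (2 * n) mod 2)"
  have n: "val (s(2 := u, 3 := v)) nE = n" "val (s(2 := u)) nE = n" "val s nE = n" for u v
    using Suc.prems(4) by (simp_all add: nE_def)
  have lt: "?y < 2 ^ L" using Suc.prems(3) by (simp add: bounded_def)
  have two: "(2::nat) \<le> 2 ^ L" using Suc.prems(1) self_le_power[of 2 L] by simp
  show ?case
    unfolding edits.simps
  proof (rule reaches_Seq[OF reaches_Seq])
    have "?y mod (2 * n) mod 2 < 2" by simp
    with two have "?y mod (2 * n) mod 2 < 2 ^ L" by linarith
    then show "reaches L X (Assign 2 (Div (modE (var 4) (Mul (Num 2) nE)) (Num 2))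
        (modE (modE (var 4) (Mul (Num 2) nE)) (Num 2))) s (\<lambda>s'. s' = s(2 := ?h))"
      using Suc.prems n by (intro reaches_Assign) auto
  next
    fix s' assume s': "bounded L s'" "s' = s(2 := ?h)"
    have "?y div (2 * n) < 2 ^ L" using div_le_dividend lt by (rule le_less_trans)
    then show "reaches L X (Assign 3 (Num 4) (Div (var 4) (Mul (Num 2) nE))) s'
        (\<lambda>s'. s' = s(2 := ?h, 3 := (s 3)(4 := ?y div (2 * n))))"
      using Suc.prems s' n by (intro reaches_Assign) auto
  next
    fix s' assume s': "bounded L s'" "s' = s(2 := ?h, 3 := (s 3)(4 := ?y div (2 * n)))"
    have "s'(2 := edit n w (s' 3 4) (s' 2), 3 := (s' 3)(4 := s' 3 4 div (2 * n) ^ w)) =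
        s(2 := edit n (Suc w) ?y (s 2), 3 := (s 3)(4 := ?y div (2 * n) ^ Suc w))"
      unfolding s'(2) by (simp add: fun_eq_iff div_mult2_eq)
    then have "Q (s'(2 := edit n w (s' 3 4) (s' 2), 3 := (s' 3)(4 := s' 3 4 div (2 * n) ^ w)))"
      using Suc.prems(5) by (simp only:)
    moreover have "s' 0 2 = n" using Suc.prems(4) s'(2) by simp
    ultimately show "reaches L X (edits w) s' Q"
      using Suc.IH Suc.prems(1,2) s'(1) by blast
  qed
qed

text \<open>The contents of array \<open>2\<close> are specified only below \<open>n\<close>; edits
  preserve agreement on this range.\<close>

lemma edit_cong:
  assumes "\<And>i. i < n \<Longrightarrow> h i = h' i" "i < n"
  shows "edit n w y h i = edit n w y h' i"
  using assms
proof (induction w arbitrary: y h h')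
  case (Suc w)
  have "(h(u := v)) l = (h'(u := v)) l" if "l < n" for u v l using Suc.prems(1)[OF that] by simp
  then show ?case unfolding edit.simps using Suc.prems(2) by (intro Suc.IH)
qed simp

lemma edit_le_1:
  assumes "\<And>i. h i \<le> 1"
  shows "edit n w y h i \<le> 1"
  using assms
proof (induction w arbitrary: y h)
  case (Suc w)
  have "(h(u := v mod 2)) i \<le> 1" for u v i :: nat using Suc.prems by auto
  then show ?case using Suc.IH by simp
qed auto

text \<open>The head \<open>v\<close> of the list becomes the lowest digit
  \<open>2 * v + f v\<close>. Repeated positions are harmless because every occurrence writes the
  same value, so a list may be padded to length \<open>w\<close>.\<close>

lemma edit_surj:
  assumes "length vs = w" "set vs \<subseteq> {..<n}" "\<And>i. f i \<le> 1"
  shows "\<exists>y < (2 * n) ^ w. \<forall>i. edit n w y h i = (if i \<in> set vs then f i else h i)"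
  using assms(1,2)
proof (induction w arbitrary: vs h)
  case 0
  then show ?case by simp
next
  case (Suc w)
  then obtain v us where vs: "vs = v # us" by (cases vs) auto
  have v: "v < n" using Suc.prems vs by simp
  let ?d = "2 * v + f v"
  have us: "length us = w" "set us \<subseteq> {..<n}" using Suc.prems vs by auto
  obtain y where y: "y < (2 * n) ^ w"
    and ed: "\<And>i. edit n w y (h(v := f v)) i = (if i \<in> set us then f i else (h(v := f v)) i)"
    using Suc.IH[OF us, of "h(v := f v)"] by blast
  have fv: "f v < 2" using assms(3)[of v] by simp
  have d: "?d < 2 * n" using v fv by linarith
  have "(?d + 2 * n * y) div (2 * n) = y" "(?d + 2 * n * y) mod (2 * n) = ?d"
    using d v by simp_all
  moreover have "?d div 2 = v" "?d mod 2 = f v" using fv by simp_all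
  ultimately have "edit n (Suc w) (?d + 2 * n * y) h = edit n w y (h(v := f v))" by simp
  moreover have "?d + 2 * n * y < (2 * n) ^ Suc w"
  proof -
    have "?d + 2 * n * y < 2 * n * Suc y" using d by simp
    also have "\<dots> \<le> 2 * n * (2 * n) ^ w" using y by (intro mult_le_mono2) simp
    finally show ?thesis by simp
  qed
  moreover have "(if i \<in> set us then f i else (h(v := f v)) i) = (if i \<in> set vs then f i else h i)" for i
    by (simp add: vs)
  ultimately show ?case using ed by metis
qed

section \<open>Execution on encoded instances\<close>

lemma sum_indicator:
  fixes h :: "nat \<Rightarrow> nat"
  assumes "S \<subseteq> {..<n}"
  shows "(\<Sum>i<n. of_bool (i \<in> S) * h i) = sum h S"
proof -
  have "(\<Sum>i<n. of_bool (i \<in> S) * h i) = (\<Sum>i\<in>S. of_bool (i \<in> S) * h i)"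
    using assms by (intro sum.mono_neutral_right) auto
  also have "\<dots> = sum h S" by (intro sum.cong) auto
  finally show ?thesis .
qed

lemma sum_indicator_filter:
  fixes h :: "nat \<Rightarrow> nat"
  assumes "S \<subseteq> {..<n}"
  shows "(\<Sum>i<n. of_bool (i \<in> S) * (of_bool (P i) * h i)) = sum h {i \<in> S. P i}"
proof -
  have "(\<Sum>i<n. of_bool (i \<in> S) * (of_bool (P i) * h i)) = (\<Sum>i<n. of_bool (i \<in> {i \<in> S. P i}) * h i)"
    by (intro sum.cong) auto
  also have "\<dots> = sum h {i \<in> S. P i}" using assms by (intro sum_indicator) auto
  finally show ?thesis .
qed

lemma output_of_eq:
  assumes len: "s 1 0 = 3 + 2 * n" and "s 1 1 = u" "s 1 2 = v" "s 1 3 = t"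
    and N: "\<And>i. i < n \<Longrightarrow> s 1 (4 + i) = of_bool (i \<in> S)"
    and S: "\<And>i. i < n \<Longrightarrow> s 1 (4 + n + i) = of_bool (i \<in> S)"
  shows "output_of s = [u, v, t] @ indicator_list n S @ indicator_list n S"
proof (rule nth_equalityI)
  show "length (output_of s) = length ([u, v, t] @ indicator_list n S @ indicator_list n S)"
    using len by (simp add: output_of_def indicator_list_def)
next
  fix i assume "i < length (output_of s)"
  then have i: "i < 3 + 2 * n" using len by (simp add: output_of_def)
  then have lhs: "output_of s ! i = s 1 (Suc i)" using len by (simp add: output_of_def)
  consider "i = 0" | "i = 1" | "i = 2" | l where "i = 3 + l" "l < n" | l where "i = 3 + n + l" "l < n"
  proof -
    have "i = 0 \<or> i = 1 \<or> i = 2 \<or> (i = 3 + (i - 3) \<and> i - 3 < n) \<or> (i = 3 + n + (i - 3 - n) \<and> i - 3 - n < n)"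
      using i by linarith
    then show thesis using that by blast
  qed
  then show "output_of s ! i = ([u, v, t] @ indicator_list n S @ indicator_list n S) ! i"
  proof cases
    case (4 l)
    then show ?thesis using lhs N[of l] by (simp add: indicator_list_def nth_append)
  next
    case (5 l)
    then show ?thesis using lhs S[of l] by (simp add: indicator_list_def nth_append add.assoc)
  qed (use lhs assms in \<open>simp_all add: numeral_2_eq_2 numeral_3_eq_3\<close>)
qed

section \<open>Encoded instances and their candidates\<close>

text \<open>\<open>N\<close> stands for the input size, and \<open>L\<close> bounds the bit length
  of every cell during the run. The factor \<open>2 * w + 5\<close> comes from the number of
  candidates: \<open>m * n ^ 4\<close> accounts for \<open>5 * N\<close> bits and
  \<open>(2 * n) ^ w\<close> for \<open>2 * w * N\<close> bits.\<close>

locale encoded_instance =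
  fixes m n w N L :: nat and A :: "nat \<Rightarrow> nat \<Rightarrow> nat" and d num den inp :: "nat \<Rightarrow> nat"
  assumes inp_m: "inp 1 = m" and inp_n: "inp 2 = n"
    and inp_A: "r < m \<Longrightarrow> i < n \<Longrightarrow> inp (3 + (r * n + i)) = A r i"
    and inp_d: "r < m \<Longrightarrow> inp (3 + (m * n + r)) = d r"
    and inp_num: "i < n \<Longrightarrow> inp (3 + (m * n + (m + n) + i)) = num i"
    and inp_den: "i < n \<Longrightarrow> inp (3 + (m * n + (m + 2 * n) + i)) = den i"
    and inp_less: "inp i < 2 ^ N"
    and num_le_den: "i < n \<Longrightarrow> num i \<le> den i" and den_pos: "i < n \<Longrightarrow> 0 < den i"
    and prod_den_le: "prod den {..<n} \<le> 2 ^ N"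
    and N_ge: "2 \<le> N" and L_def: "L = (2 * w + 5) * N"
begin

definition common_den :: nat where
  "common_den = prod den {..<n}"

definition scaled :: "nat \<Rightarrow> nat" where
  "scaled i = num i * common_den div den i"

definition candidates :: nat where
  "candidates = m * (n ^ 4 * (2 * n) ^ w)"

definition rank_key :: "nat \<Rightarrow> nat \<Rightarrow> nat" where
  "rank_key r i = A r i * n + i"

text \<open>The digits of a candidate number in the order in which \<open>prepare\<close> extracts
  them: the row in base \<open>m\<close>, four indices in base \<open>n\<close>, and the code of the
  edits as the remaining quotient.\<close>

definition row_of :: "nat \<Rightarrow> nat" where "row_of z = z mod m"
definition t_of :: "nat \<Rightarrow> nat" where "t_of z = z div m mod n"
definition j_of :: "nat \<Rightarrow> nat" where "j_of z = z div m div n mod n"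
definition p_of :: "nat \<Rightarrow> nat" where "p_of z = z div m div n div n mod n"
definition p'_of :: "nat \<Rightarrow> nat" where "p'_of z = z div m div n div n div n mod n"
definition code_of :: "nat \<Rightarrow> nat" where "code_of z = z div m div n div n div n div n"

definition base_of :: "nat \<Rightarrow> nat set" where
  "base_of z = {i. i < n \<and> num i = den i \<and> rank_key (row_of z) (j_of z) \<le> rank_key (row_of z) i \<and>
     A (row_of z) i + A (row_of z) (t_of z) \<le> d (row_of z)}"

definition cells :: "nat \<Rightarrow> nat \<Rightarrow> nat" where
  "cells z = (edit n w (code_of z) (\<lambda>i. of_bool (i \<in> base_of z)))(t_of z := 0)"

definition chosen :: "nat \<Rightarrow> nat set" where
  "chosen z = {i. i < n \<and> cells z i = 1}"

definition low :: "nat \<Rightarrow> nat set" where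
  "low z = {i \<in> chosen z. rank_key (row_of z) i \<le> rank_key (row_of z) (p_of z)}"

definition high :: "nat \<Rightarrow> nat set" where
  "high z = {i \<in> chosen z. rank_key (row_of z) (p'_of z) \<le> rank_key (row_of z) i}"

text \<open>The integer form of \<open>accepts\<close> for a candidate: the last inequality is
  multiplied by \<open>common_den\<close>.\<close>

definition good :: "nat \<Rightarrow> bool" where
  "good z \<longleftrightarrow> 2 \<le> card (low z) \<and> card (high z) + 1 = card (low z) \<and>
     sum (A (row_of z)) (chosen z) \<le> d (row_of z) \<and>
     d (row_of z) < A (row_of z) (t_of z) + sum (A (row_of z)) (low z) \<and>
     A (row_of z) (t_of z) + sum (A (row_of z)) (high z) \<le> d (row_of z) \<and>
     card (chosen z) * common_den <
       (card (chosen z) + 1 - card (low z)) * scaled (t_of z) + sum scaled (chosen z)"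

definition answer :: "nat \<Rightarrow> nat list" where
  "answer z = [row_of z, card (low z), t_of z] @ indicator_list n (chosen z) @ indicator_list n (chosen z)"

lemma L_ge: "5 * N \<le> L" "1 \<le> L"
proof -
  show "5 * N \<le> L" unfolding L_def by (intro mult_le_mono1) simp
  then show "1 \<le> L" using N_ge by linarith
qed

lemma n_less: "n < 2 ^ N" and m_less: "m < 2 ^ N"
  using inp_less[of 1] inp_less[of 2] inp_m inp_n by simp_all

lemma two_power_le: "2 ^ (k * N) \<le> (2::nat) ^ L" if "k \<le> 5"
proof -
  have "k * N \<le> 5 * N" using that by (rule mult_le_mono1)
  then show ?thesis using L_ge(1) by (intro power_increasing) linarith+
qed

lemma less_L: "u < 2 ^ L" if "u < 2 ^ N" for u :: nat
  using that two_power_le[of 1] by (simp only: mult_1) linarith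

lemma n_less_L: "n < 2 ^ L"
  using n_less by (rule less_L)

lemma four_le: "4 \<le> (2::nat) ^ N"
  using power_increasing[of 2 N "2::nat"] N_ge by simp

lemma of_bool_less_L: "of_bool P < (2::nat) ^ L"
  by (rule less_L) (use four_le in \<open>simp add: of_bool_def\<close>)

lemma candidates_less: "candidates < 2 ^ L"
proof -
  have "2 * n \<le> 2 ^ N * 2 ^ N" using n_less four_le by (intro mult_le_mono) linarith+
  then have "(2 * n) ^ w \<le> (2 ^ N * 2 ^ N) ^ w" by (rule power_mono) simp
  moreover have "n ^ 4 \<le> (2 ^ N) ^ 4" using n_less by (intro power_mono) auto
  ultimately have "n ^ 4 * (2 * n) ^ w \<le> (2 ^ N) ^ 4 * (2 ^ N * 2 ^ N) ^ w"
    by (intro mult_le_mono)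
  then have "candidates \<le> m * ((2 ^ N) ^ 4 * (2 ^ N * 2 ^ N) ^ w)"
    unfolding candidates_def by (rule mult_le_mono2)
  also have "\<dots> < 2 ^ N * ((2 ^ N) ^ 4 * (2 ^ N * 2 ^ N) ^ w)"
    using m_less by (intro mult_strict_right_mono) auto
  also have "\<dots> = 2 ^ L"
    unfolding L_def by (simp add: power_add[symmetric] power_mult[symmetric] algebra_simps)
  finally show ?thesis .
qed

text \<open>If a dimension is 0, there are no candidates. So whenever a candidate is decoded, the
  remainders modulo \<open>m\<close> and \<open>n\<close> are valid indices.\<close>

lemma candidates_pos: "0 < m" "0 < n" if "z < candidates"
  using that by (auto simp: candidates_def intro: ccontr)

lemma scaled_le: "scaled i \<le> 2 ^ N" if "i < n"
proof -
  have "num i * common_den \<le> den i * common_den" using num_le_den[OF that] by (rule mult_le_mono1)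
  then have "scaled i \<le> den i * common_den div den i" unfolding scaled_def by (rule div_le_mono)
  also have "\<dots> = common_den" using den_pos[OF that] by simp
  finally show ?thesis using prod_den_le by (simp add: common_den_def)
qed

lemma A_le: "A r i \<le> 2 ^ N" if "r < m" "i < n"
  using inp_A[OF that] inp_less by (metis order_less_imp_le)

lemma sum_less_L: "sum g {..<n} < 2 ^ L" if "\<And>i. i < n \<Longrightarrow> g i \<le> 2 ^ N" for g :: "nat \<Rightarrow> nat"
proof -
  have "sum g {..<n} \<le> n * 2 ^ N" using sum_bounded_above[of "{..<n}" g "2 ^ N"] that by simp
  also have "\<dots> < 2 ^ N * 2 ^ N" using n_less by simp
  also have "\<dots> = 2 ^ (2 * N)" by (simp add: power_add mult_2)
  also have "\<dots> \<le> 2 ^ L" by (rule two_power_le) simp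
  finally show ?thesis .
qed

lemma val_nE: "s 0 = inp \<Longrightarrow> val s nE = n"
  by (simp add: nE_def inp_n)

lemma val_mE: "s 0 = inp \<Longrightarrow> val s mE = m"
  using inp_m by (simp add: mE_def)

lemma val_entryE:
  "s 0 = inp \<Longrightarrow> s 3 5 < m \<Longrightarrow> val s e < n \<Longrightarrow> val s (entryE e) = A (s 3 5) (val s e)"
  using inp_A by (simp add: entryE_def val_nE)

lemma val_keyE:
  "s 0 = inp \<Longrightarrow> s 3 5 < m \<Longrightarrow> val s e < n \<Longrightarrow> val s (keyE e) = rank_key (s 3 5) (val s e)"
  by (simp add: keyE_def val_nE val_entryE rank_key_def)

lemma val_rhsE: "s 0 = inp \<Longrightarrow> s 3 5 < m \<Longrightarrow> val s rhsE = d (s 3 5)"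
  using inp_d by (simp add: rhsE_def val_nE val_mE)

lemma val_numE: "s 0 = inp \<Longrightarrow> val s e < n \<Longrightarrow> val s (numE e) = num (val s e)"
  using inp_num by (simp add: numE_def val_nE val_mE)

lemma val_denE: "s 0 = inp \<Longrightarrow> val s e < n \<Longrightarrow> val s (denE e) = den (val s e)"
  using inp_den by (simp add: denE_def val_nE val_mE)

lemma val_scaledE:
  "s 0 = inp \<Longrightarrow> s 3 1 = common_den \<Longrightarrow> val s e < n \<Longrightarrow> val s (scaledE e) = scaled (val s e)"
  by (simp add: scaledE_def val_numE val_denE scaled_def)

lemmas val_simps = val_nE val_mE val_entryE val_keyE val_rhsE val_numE val_denE val_scaledE

lemma chosen_subset: "chosen z \<subseteq> {..<n}"
  by (auto simp: chosen_def)

lemma cells_eq: "cells z i = of_bool (i \<in> chosen z)" if "i < n"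
proof -
  have "edit n w (code_of z) (\<lambda>i. of_bool (i \<in> base_of z)) i \<le> 1" by (intro edit_le_1) simp
  then have "cells z i \<le> 1" by (simp add: cells_def)
  then show ?thesis using that by (auto simp: chosen_def)
qed

section \<open>Assertions for the parts of the program\<close>

lemma reaches_prepare:
  assumes b: "bounded L s" and s: "s 0 = inp" "s 3 3 = z" and z: "z < candidates"
  shows "reaches L (Suc n * L) (prepare w) s
    (\<lambda>s'. s' 0 = inp \<and> s' 1 = s 1 \<and> s' 3 1 = s 3 1 \<and> s' 3 2 = s 3 2 \<and> s' 3 3 = z \<and>
      s' 3 5 = row_of z \<and> s' 3 6 = t_of z \<and> s' 3 7 = j_of z \<and> s' 3 8 = p_of z \<and> s' 3 9 = p'_of z \<and>
      (\<forall>i<n. s' 2 i = of_bool (i \<in> chosen z)))"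
proof -
  define F where "F s' \<longleftrightarrow> s' 0 = inp \<and> s' 1 = s 1 \<and> s' 3 1 = s 3 1 \<and> s' 3 2 = s 3 2 \<and> s' 3 3 = z" for s' :: store
  note L = L_ge(2)
  have LX: "L \<le> Suc n * L" by simp
  note pos = candidates_pos[OF z]
  have zL: "z < 2 ^ L" using z candidates_less by linarith
  have lt: "row_of z < m" "t_of z < n" "j_of z < n" using pos by (simp_all add: row_of_def t_of_def j_of_def)
  \<comment> \<open>The assertions after the five decoding steps; each adds the variable just
    decoded and records what is left in variable \<open>4\<close>.\<close>
  define R5 where "R5 s' \<longleftrightarrow> F s' \<and> s' 3 4 = z div m \<and> s' 3 5 = row_of z" for s'
  define R6 where "R6 s' \<longleftrightarrow> F s' \<and> s' 3 4 = z div m div n \<and> s' 3 5 = row_of z \<and> s' 3 6 = t_of z" for s' :: store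
  define R7 where "R7 s' \<longleftrightarrow> F s' \<and> s' 3 4 = z div m div n div n \<and> s' 3 5 = row_of z \<and> s' 3 6 = t_of z \<and>
    s' 3 7 = j_of z" for s' :: store
  define R8 where "R8 s' \<longleftrightarrow> F s' \<and> s' 3 4 = z div m div n div n div n \<and> s' 3 5 = row_of z \<and> s' 3 6 = t_of z \<and>
    s' 3 7 = j_of z \<and> s' 3 8 = p_of z" for s' :: store
  define R9 where "R9 s' \<longleftrightarrow> F s' \<and> s' 3 4 = code_of z \<and> s' 3 5 = row_of z \<and> s' 3 6 = t_of z \<and>
    s' 3 7 = j_of z \<and> s' 3 8 = p_of z \<and> s' 3 9 = p'_of z" for s' :: store
  have h1: "reaches L (Suc n * L) (Assign 3 (Num 4) (var 3)) s (\<lambda>s'. F s' \<and> s' 3 4 = z)"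
    using L LX b s zL by (intro reaches_Assign) (auto simp: F_def)
  have h2: "reaches L (Suc n * L) (decode 5 mE) s' R5" if "bounded L s'" "F s' \<and> s' 3 4 = z" for s'
    using L LX that by (intro reaches_decode[where v = m]) (auto simp: F_def R5_def val_mE row_of_def)
  have h3: "reaches L (Suc n * L) (decode 6 nE) s' R6" if "bounded L s'" "R5 s'" for s'
    using L LX that by (intro reaches_decode[where v = n]) (auto simp: F_def R5_def R6_def val_nE t_of_def)
  have h4: "reaches L (Suc n * L) (decode 7 nE) s' R7" if "bounded L s'" "R6 s'" for s'
    using L LX that by (intro reaches_decode[where v = n]) (auto simp: F_def R6_def R7_def val_nE j_of_def)
  have h5: "reaches L (Suc n * L) (decode 8 nE) s' R8" if "bounded L s'" "R7 s'" for s'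
    using L LX that by (intro reaches_decode[where v = n]) (auto simp: F_def R7_def R8_def val_nE p_of_def)
  have h6: "reaches L (Suc n * L) (decode 9 nE) s' R9" if "bounded L s'" "R8 s'" for s'
    using L LX that
    by (intro reaches_decode[where v = n]) (auto simp: F_def R8_def R9_def val_nE p'_of_def code_of_def)
  have h7: "reaches L (Suc n * L) (fill_loop nE 2 (Num 0) baseE) s'
      (\<lambda>s'. R9 s' \<and> (\<forall>i<n. s' 2 i = of_bool (i \<in> base_of z)))" if b': "bounded L s'" and R: "R9 s'" for s'
  proof (rule reaches_fill_loop[where g = "\<lambda>i. of_bool (i \<in> base_of z)" and c = 0, OF L order_refl n_less_L b'])
    show "val (s'(2 := u, 3 := (s' 3)(0 := i))) nE = n" for u i
      using R by (simp add: R9_def F_def val_nE)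
    show "val (s'(2 := u, 3 := (s' 3)(0 := i))) baseE = of_bool (i \<in> base_of z)" if "i < n" for u i
      using R lt that by (simp add: R9_def F_def baseE_def val_simps base_of_def)
    show "of_bool (i \<in> base_of z) < (2::nat) ^ L" for i
      by (rule of_bool_less_L)
  qed (use R in \<open>auto simp: R9_def F_def\<close>)
  \<comment> \<open>\<open>edits\<close> consumes variable \<open>4\<close>, so \<open>R9\<close> is
    asserted for the store in which that variable is put back.\<close>
  have h8: "reaches L (Suc n * L) (edits w) s'
      (\<lambda>s'. R9 (s'(3 := (s' 3)(4 := code_of z))) \<and> (\<forall>i<n. s' 2 i = edit n w (code_of z) (\<lambda>i. of_bool (i \<in> base_of z)) i))"
    if b': "bounded L s'" and R: "R9 s' \<and> (\<forall>i<n. s' 2 i = of_bool (i \<in> base_of z))" for s'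
  proof (rule reaches_edits[where n = n, OF L LX b'])
    show "s' 0 2 = n" using R inp_n by (simp add: R9_def F_def)
    have "edit n w (code_of z) (s' 2) i = edit n w (code_of z) (\<lambda>i. of_bool (i \<in> base_of z)) i" if "i < n" for i
      using R that by (intro edit_cong) auto
    then show "R9 ((s'(2 := edit n w (s' 3 4) (s' 2), 3 := (s' 3)(4 := s' 3 4 div (2 * n) ^ w)))
        (3 := ((s'(2 := edit n w (s' 3 4) (s' 2), 3 := (s' 3)(4 := s' 3 4 div (2 * n) ^ w))) 3)(4 := code_of z))) \<and>
        (\<forall>i<n. (s'(2 := edit n w (s' 3 4) (s' 2), 3 := (s' 3)(4 := s' 3 4 div (2 * n) ^ w))) 2 i =
          edit n w (code_of z) (\<lambda>i. of_bool (i \<in> base_of z)) i)"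
      using R by (simp add: R9_def F_def)
  qed
  have h9: "reaches L (Suc n * L) (Assign 2 (var 6) (Num 0)) s'
    (\<lambda>s'. s' 0 = inp \<and> s' 1 = s 1 \<and> s' 3 1 = s 3 1 \<and> s' 3 2 = s 3 2 \<and> s' 3 3 = z \<and>
      s' 3 5 = row_of z \<and> s' 3 6 = t_of z \<and> s' 3 7 = j_of z \<and> s' 3 8 = p_of z \<and> s' 3 9 = p'_of z \<and>
      (\<forall>i<n. s' 2 i = of_bool (i \<in> chosen z)))"
    if b': "bounded L s'" and R: "R9 (s'(3 := (s' 3)(4 := code_of z))) \<and>
      (\<forall>i<n. s' 2 i = edit n w (code_of z) (\<lambda>i. of_bool (i \<in> base_of z)) i)" for s'
  proof (rule reaches_Assign[OF b' L LX])
    let ?s = "s'(2 := (s' 2)(val s' (var 6) := val s' (Num 0)))"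
    have "?s 2 i = of_bool (i \<in> chosen z)" if "i < n" for i
      using cells_eq[OF that, of z] R that by (auto simp: R9_def F_def cells_def)
    then show "?s 0 = inp \<and> ?s 1 = s 1 \<and> ?s 3 1 = s 3 1 \<and> ?s 3 2 = s 3 2 \<and> ?s 3 3 = z \<and>
      ?s 3 5 = row_of z \<and> ?s 3 6 = t_of z \<and> ?s 3 7 = j_of z \<and> ?s 3 8 = p_of z \<and> ?s 3 9 = p'_of z \<and>
      (\<forall>i<n. ?s 2 i = of_bool (i \<in> chosen z))"
      using R by (simp add: R9_def F_def)
  qed simp
  show ?thesis
    unfolding prepare_def
    by (rule reaches_Seq, rule h1,
        rule reaches_Seq, rule h2, assumption, assumption,
        rule reaches_Seq, rule h3, assumption, assumption,
        rule reaches_Seq, rule h4, assumption, assumption,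
        rule reaches_Seq, rule h5, assumption, assumption,
        rule reaches_Seq, rule h6, assumption, assumption,
        rule reaches_Seq, rule h7, assumption, assumption,
        rule reaches_Seq, rule h8, assumption, assumption,
        rule h9, assumption, assumption)
qed

text \<open>The loop counter and the cells of array \<open>3\<close> from \<open>10\<close> on,
  which receive the sums, may change.\<close>

definition frame :: "store \<Rightarrow> store \<Rightarrow> bool" where
  "frame s0 s \<longleftrightarrow> s 0 = inp \<and> s 1 = s0 1 \<and> s 2 = s0 2 \<and> (\<forall>c. 1 \<le> c \<longrightarrow> c < 10 \<longrightarrow> s 3 c = s0 3 c)"

text \<open>The last conjunct carries the sums already computed, in the cells below
  \<open>c\<close>, through the later loops.\<close>

lemma reaches_sum_loops:
  assumes "bounded L s" "frame s0 s" "10 \<le> c" "length es = length gs"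
    and "\<And>l s i. l < length es \<Longrightarrow> frame s0 s \<Longrightarrow> s 3 0 = i \<Longrightarrow> i < n \<Longrightarrow> val s (es ! l) = (gs ! l) i"
    and "\<And>l i. l < length es \<Longrightarrow> i < n \<Longrightarrow> (gs ! l) i \<le> 2 ^ N"
  shows "reaches L (Suc n * L) (sum_loops c es) s
    (\<lambda>s'. frame s0 s' \<and> (\<forall>l<length es. s' 3 (c + l) = sum (gs ! l) {..<n}) \<and>
      (\<forall>c'. 10 \<le> c' \<longrightarrow> c' < c \<longrightarrow> s' 3 c' = s 3 c'))"
  using assms
proof (induction es arbitrary: s c gs)
  case Nil
  then show ?case using L_ge(2) by (auto intro!: reaches_Skip)
next
  case (Cons e es)
  then obtain g gs' where gs: "gs = g # gs'" by (cases gs) auto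
  have g: "g i \<le> 2 ^ N" if "i < n" for i using Cons.prems(6)[of 0 i] that gs by simp
  have e: "val s e = g i" if "frame s0 s" "s 3 0 = i" "i < n" for s i
    using Cons.prems(5)[of 0 s i] that gs by simp
  have upd: "frame s0 (s(3 := (s 3)(c := u, 0 := i)))" for u i
    using Cons.prems(2,3) by (auto simp: frame_def)
  show ?case
    unfolding sum_loops.simps
  proof (rule reaches_Seq)
    show "reaches L (Suc n * L) (sum_loop nE c e) s
        (\<lambda>s'. frame s0 s' \<and> s' 3 c = sum g {..<n} \<and> (\<forall>c'. 10 \<le> c' \<longrightarrow> c' < c \<longrightarrow> s' 3 c' = s 3 c'))"
    proof (rule reaches_sum_loop[OF L_ge(2) order_refl n_less_L Cons.prems(1), of c nE e g])
      show "val (s(3 := (s 3)(c := u, 0 := i))) nE = n" for u i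
        using upd by (intro val_nE) (simp add: frame_def)
      show "val (s(3 := (s 3)(c := u, 0 := i))) e = g i" if "i < n" for u i
        using upd that by (intro e) auto
      show "sum g {..<n} < 2 ^ L" using g by (rule sum_less_L)
    qed (use Cons.prems(3) upd in auto)
  next
    fix s' assume s': "bounded L s'" "frame s0 s' \<and> s' 3 c = sum g {..<n} \<and>
      (\<forall>c'. 10 \<le> c' \<longrightarrow> c' < c \<longrightarrow> s' 3 c' = s 3 c')"
    have "reaches L (Suc n * L) (sum_loops (Suc c) es) s'
      (\<lambda>s''. frame s0 s'' \<and> (\<forall>l<length es. s'' 3 (Suc c + l) = sum (gs' ! l) {..<n}) \<and>
        (\<forall>c'. 10 \<le> c' \<longrightarrow> c' < Suc c \<longrightarrow> s'' 3 c' = s' 3 c'))"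
    proof (rule Cons.IH)
      show "val s (es ! l) = (gs' ! l) i" if "l < length es" "frame s0 s" "s 3 0 = i" "i < n" for l s i
        using Cons.prems(5)[of "Suc l" s i] that gs by simp
      show "(gs' ! l) i \<le> 2 ^ N" if "l < length es" "i < n" for l i
        using Cons.prems(6)[of "Suc l" i] that gs by simp
    qed (use s' Cons.prems gs in auto)
    then show "reaches L (Suc n * L) (sum_loops (Suc c) es) s'
      (\<lambda>s'. frame s0 s' \<and> (\<forall>l<length (e # es). s' 3 (c + l) = sum (gs ! l) {..<n}) \<and>
        (\<forall>c'. 10 \<le> c' \<longrightarrow> c' < c \<longrightarrow> s' 3 c' = s 3 c'))"
    proof (rule reaches_mono[OF _ order_refl])
      fix s'' assume s'': "frame s0 s'' \<and> (\<forall>l<length es. s'' 3 (Suc c + l) = sum (gs' ! l) {..<n}) \<and>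
        (\<forall>c'. 10 \<le> c' \<longrightarrow> c' < Suc c \<longrightarrow> s'' 3 c' = s' 3 c')"
      have "s'' 3 (c + l) = sum (gs ! l) {..<n}" if "l < length (e # es)" for l
        using s' s'' that Cons.prems(3) gs by (cases l) auto
      then show "frame s0 s'' \<and> (\<forall>l<length (e # es). s'' 3 (c + l) = sum (gs ! l) {..<n}) \<and>
        (\<forall>c'. 10 \<le> c' \<longrightarrow> c' < c \<longrightarrow> s'' 3 c' = s 3 c')"
        using s' s'' by auto
    qed
  qed
qed

lemma reaches_evaluate:
  assumes b: "bounded L s" and z: "z < candidates"
    and s: "s 0 = inp" "s 3 1 = common_den" "s 3 5 = row_of z" "s 3 6 = t_of z" "s 3 8 = p_of z" "s 3 9 = p'_of z"
      "\<And>i. i < n \<Longrightarrow> s 2 i = of_bool (i \<in> chosen z)"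
  shows "reaches L (Suc n * L) evaluate s
    (\<lambda>s'. frame s s' \<and> s' 3 10 = card (chosen z) \<and> s' 3 11 = sum (A (row_of z)) (chosen z) \<and>
      s' 3 12 = card (low z) \<and> s' 3 13 = card (high z) \<and> s' 3 14 = sum (A (row_of z)) (low z) \<and>
      s' 3 15 = sum (A (row_of z)) (high z) \<and> s' 3 16 = sum scaled (chosen z))"
proof -
  let ?r = "row_of z" and ?S = "chosen z"
  let ?L = "\<lambda>i. rank_key ?r i \<le> rank_key ?r (p_of z)" and ?H = "\<lambda>i. rank_key ?r (p'_of z) \<le> rank_key ?r i"
  note pos = candidates_pos[OF z]
  have lt: "?r < m" "p_of z < n" "p'_of z < n" using pos by (simp_all add: row_of_def p_of_def p'_of_def)
  \<comment> \<open>The factors \<open>1\<close> bring the cardinalities into the form of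
    \<open>sum_indicator\<close> and \<open>sum_indicator_filter\<close>.\<close>
  define gs :: "(nat \<Rightarrow> nat) list" where "gs =
    [\<lambda>i. of_bool (i \<in> ?S) * 1,
     \<lambda>i. of_bool (i \<in> ?S) * A ?r i,
     \<lambda>i. of_bool (i \<in> ?S) * (of_bool (?L i) * 1),
     \<lambda>i. of_bool (i \<in> ?S) * (of_bool (?H i) * 1),
     \<lambda>i. of_bool (i \<in> ?S) * (of_bool (?L i) * A ?r i),
     \<lambda>i. of_bool (i \<in> ?S) * (of_bool (?H i) * A ?r i),
     \<lambda>i. of_bool (i \<in> ?S) * scaled i]"
  have nths: "gs ! 0 = (\<lambda>i. of_bool (i \<in> ?S) * 1)" "gs ! 1 = (\<lambda>i. of_bool (i \<in> ?S) * A ?r i)"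
    "gs ! 2 = (\<lambda>i. of_bool (i \<in> ?S) * (of_bool (?L i) * 1))"
    "gs ! 3 = (\<lambda>i. of_bool (i \<in> ?S) * (of_bool (?H i) * 1))"
    "gs ! 4 = (\<lambda>i. of_bool (i \<in> ?S) * (of_bool (?L i) * A ?r i))"
    "gs ! 5 = (\<lambda>i. of_bool (i \<in> ?S) * (of_bool (?H i) * A ?r i))"
    "gs ! 6 = (\<lambda>i. of_bool (i \<in> ?S) * scaled i)"
    by (simp_all add: gs_def)
  have sums: "sum (gs ! 0) {..<n} = card ?S" "sum (gs ! 1) {..<n} = sum (A ?r) ?S"
    "sum (gs ! 2) {..<n} = card (low z)" "sum (gs ! 3) {..<n} = card (high z)"
    "sum (gs ! 4) {..<n} = sum (A ?r) (low z)" "sum (gs ! 5) {..<n} = sum (A ?r) (high z)"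
    "sum (gs ! 6) {..<n} = sum scaled ?S"
    unfolding nths low_def high_def card_eq_sum
    by (simp_all only: sum_indicator_filter[OF chosen_subset] sum_indicator[OF chosen_subset])
  have le_N: "1 \<le> (2::nat) ^ N" using four_le by linarith
  have "frame s s" using s(1) by (simp add: frame_def)
  have "reaches L (Suc n * L) evaluate s
    (\<lambda>s'. frame s s' \<and> (\<forall>l<7. s' 3 (10 + l) = sum (gs ! l) {..<n}) \<and>
      (\<forall>c'. 10 \<le> c' \<longrightarrow> c' < 10 \<longrightarrow> s' 3 c' = s 3 c'))"
    unfolding evaluate_def
  proof (rule reaches_mono[OF reaches_sum_loops[OF b \<open>frame s s\<close> order_refl, of _ gs] order_refl])
    fix l s' i
    assume l: "l < length
         [selE, Mul selE (entryE (var 0)), Mul selE (leE (keyE (var 0)) (keyE (var 8))),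
          Mul selE (leE (keyE (var 9)) (keyE (var 0))),
          Mul selE (Mul (leE (keyE (var 0)) (keyE (var 8))) (entryE (var 0))),
          Mul selE (Mul (leE (keyE (var 9)) (keyE (var 0))) (entryE (var 0))),
          Mul selE (scaledE (var 0))]" and f: "frame s s'" and i: "s' 3 0 = i" "i < n"
    have s': "s' 0 = inp" "s' 3 1 = common_den" "s' 3 5 = ?r" "s' 3 8 = p_of z" "s' 3 9 = p'_of z"
      "val s' selE = of_bool (i \<in> ?S)"
      using f s i by (simp_all add: frame_def selE_def)
    from l have "l = 0 \<or> l = 1 \<or> l = 2 \<or> l = 3 \<or> l = 4 \<or> l = 5 \<or> l = 6" by (simp add: less_Suc_eq) linarith
    then show "val s' ([selE, Mul selE (entryE (var 0)), Mul selE (leE (keyE (var 0)) (keyE (var 8))),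
          Mul selE (leE (keyE (var 9)) (keyE (var 0))),
          Mul selE (Mul (leE (keyE (var 0)) (keyE (var 8))) (entryE (var 0))),
          Mul selE (Mul (leE (keyE (var 9)) (keyE (var 0))) (entryE (var 0))),
          Mul selE (scaledE (var 0))] ! l) = (gs ! l) i"
      using s' i lt by (elim disjE) (simp_all add: gs_def val_simps)
  next
    fix l i
    assume l: "l < length
         [selE, Mul selE (entryE (var 0)), Mul selE (leE (keyE (var 0)) (keyE (var 8))),
          Mul selE (leE (keyE (var 9)) (keyE (var 0))),
          Mul selE (Mul (leE (keyE (var 0)) (keyE (var 8))) (entryE (var 0))),
          Mul selE (Mul (leE (keyE (var 9)) (keyE (var 0))) (entryE (var 0))),
          Mul selE (scaledE (var 0))]" and i: "i < n"
    from l have "l = 0 \<or> l = 1 \<or> l = 2 \<or> l = 3 \<or> l = 4 \<or> l = 5 \<or> l = 6" by (simp add: less_Suc_eq) linarith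
    then show "(gs ! l) i \<le> 2 ^ N"
      using A_le[OF lt(1) i] scaled_le[OF i] le_N by (elim disjE) (simp_all add: gs_def of_bool_def)
  qed (simp_all add: gs_def)
  then show ?thesis
  proof (rule reaches_mono[OF _ order_refl])
    fix s' assume s': "frame s s' \<and> (\<forall>l<7. s' 3 (10 + l) = sum (gs ! l) {..<n}) \<and>
      (\<forall>c'. 10 \<le> c' \<longrightarrow> c' < 10 \<longrightarrow> s' 3 c' = s 3 c')"
    then have e: "s' 3 (10 + l) = sum (gs ! l) {..<n}" if "l < 7" for l using that by blast
    show "frame s s' \<and> s' 3 10 = card (chosen z) \<and> s' 3 11 = sum (A (row_of z)) (chosen z) \<and>
      s' 3 12 = card (low z) \<and> s' 3 13 = card (high z) \<and> s' 3 14 = sum (A (row_of z)) (low z) \<and>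
      s' 3 15 = sum (A (row_of z)) (high z) \<and> s' 3 16 = sum scaled (chosen z)"
      using s' e[of 0] e[of 1] e[of 2] e[of 3] e[of 4] e[of 5] e[of 6] unfolding sums by simp
  qed
qed

lemma reaches_output:
  assumes b: "bounded L s" and s: "s 0 = inp" "\<And>i. i < n \<Longrightarrow> s 2 i = of_bool (i \<in> S)"
  shows "reaches L (Suc n * L) output_prog s
    (\<lambda>s'. s' 0 = inp \<and> (\<forall>c\<ge>1. s' 3 c = s 3 c) \<and> s' 1 0 = 3 + 2 * n \<and>
      output_of s' = [s 3 5, s 3 12, s 3 6] @ indicator_list n S @ indicator_list n S)"
proof -
  define F where "F s' \<longleftrightarrow> s' 0 = inp \<and> s' 2 = s 2 \<and> (\<forall>c\<ge>1. s' 3 c = s 3 c)" for s' :: store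
  note L = L_ge(2)
  have LX: "L \<le> Suc n * L" by simp
  have cell: "s 3 c < 2 ^ L" for c using b by (simp add: bounded_def)
  have "3 + 2 * n < 2 ^ L"
  proof -
    have "3 + 2 * n < 2 ^ N + 2 * 2 ^ N" using n_less four_le by linarith
    also have "\<dots> \<le> 2 ^ N * 2 ^ N" using four_le mult_le_mono1[of 3 "2 ^ N" "2 ^ N"] by simp
    also have "\<dots> = 2 ^ (2 * N)" by (simp add: power_add mult_2)
    also have "\<dots> \<le> 2 ^ L" by (rule two_power_le) simp
    finally show ?thesis .
  qed
  then have h1: "reaches L (Suc n * L) (Assign 1 (Num 0) (Add (Num 3) (Mul (Num 2) nE))) s
      (\<lambda>s'. F s' \<and> s' 1 0 = 3 + 2 * n)"
    using L LX b s(1) by (intro reaches_Assign) (auto simp: F_def val_nE)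
  have h2: "reaches L (Suc n * L) (Assign 1 (Num 1) (var 5)) s'
      (\<lambda>s'. F s' \<and> s' 1 0 = 3 + 2 * n \<and> s' 1 1 = s 3 5)"
    if "bounded L s'" "F s' \<and> s' 1 0 = 3 + 2 * n" for s'
    using L LX that cell by (intro reaches_Assign) (auto simp: F_def)
  have h3: "reaches L (Suc n * L) (Assign 1 (Num 2) (var 12)) s'
      (\<lambda>s'. F s' \<and> s' 1 0 = 3 + 2 * n \<and> s' 1 1 = s 3 5 \<and> s' 1 2 = s 3 12)"
    if "bounded L s'" "F s' \<and> s' 1 0 = 3 + 2 * n \<and> s' 1 1 = s 3 5" for s'
    using L LX that cell by (intro reaches_Assign) (auto simp: F_def)
  have h4: "reaches L (Suc n * L) (Assign 1 (Num 3) (var 6)) s'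
      (\<lambda>s'. F s' \<and> s' 1 0 = 3 + 2 * n \<and> s' 1 1 = s 3 5 \<and> s' 1 2 = s 3 12 \<and> s' 1 3 = s 3 6)"
    if "bounded L s'" "F s' \<and> s' 1 0 = 3 + 2 * n \<and> s' 1 1 = s 3 5 \<and> s' 1 2 = s 3 12" for s'
    using L LX that cell by (intro reaches_Assign) (auto simp: F_def)
  have h5: "reaches L (Suc n * L) (fill_loop nE 1 (Num 4) selE) s'
      (\<lambda>s'. (F s' \<and> s' 1 0 = 3 + 2 * n \<and> s' 1 1 = s 3 5 \<and> s' 1 2 = s 3 12 \<and> s' 1 3 = s 3 6) \<and>
        (\<forall>i<n. s' 1 (4 + i) = of_bool (i \<in> S)))"
    if b': "bounded L s'" and R: "F s' \<and> s' 1 0 = 3 + 2 * n \<and> s' 1 1 = s 3 5 \<and> s' 1 2 = s 3 12 \<and> s' 1 3 = s 3 6"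
    for s'
  proof (rule reaches_fill_loop[where g = "\<lambda>i. of_bool (i \<in> S)" and c = 4, OF L order_refl n_less_L b'])
    show "val (s'(1 := u, 3 := (s' 3)(0 := i))) nE = n" for u i
      using R by (simp add: F_def val_nE)
    show "val (s'(1 := u, 3 := (s' 3)(0 := i))) selE = of_bool (i \<in> S)" if "i < n" for u i
      using R s(2) that by (simp add: F_def selE_def)
  qed (use R of_bool_less_L in \<open>auto simp: F_def\<close>)
  have h6: "reaches L (Suc n * L) (fill_loop nE 1 (Add (Num 4) nE) selE) s'
      (\<lambda>s'. s' 0 = inp \<and> (\<forall>c\<ge>1. s' 3 c = s 3 c) \<and> s' 1 0 = 3 + 2 * n \<and>
        output_of s' = [s 3 5, s 3 12, s 3 6] @ indicator_list n S @ indicator_list n S)"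
    if b': "bounded L s'" and R: "(F s' \<and> s' 1 0 = 3 + 2 * n \<and> s' 1 1 = s 3 5 \<and> s' 1 2 = s 3 12 \<and> s' 1 3 = s 3 6) \<and>
        (\<forall>i<n. s' 1 (4 + i) = of_bool (i \<in> S))" for s'
  proof (rule reaches_fill_loop[where g = "\<lambda>i. of_bool (i \<in> S)" and c = "4 + n", OF L order_refl n_less_L b'])
    show "val (s'(1 := u, 3 := (s' 3)(0 := i))) nE = n" for u i
      using R by (simp add: F_def val_nE)
    show "val (s'(1 := u, 3 := (s' 3)(0 := i))) (Add (Num 4) nE) = 4 + n" for u i
      using R by (simp add: F_def val_nE)
    show "val (s'(1 := u, 3 := (s' 3)(0 := i))) selE = of_bool (i \<in> S)" if "i < n" for u i
      using R s(2) that by (simp add: F_def selE_def)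
    let ?s = "s'(1 := (\<lambda>j. if 4 + n \<le> j \<and> j < 4 + n + n then of_bool (j - (4 + n) \<in> S) else s' 1 j),
      3 := (s' 3)(0 := n))"
    have "output_of ?s = [s 3 5, s 3 12, s 3 6] @ indicator_list n S @ indicator_list n S"
      using R by (intro output_of_eq) auto
    then show "?s 0 = inp \<and> (\<forall>c\<ge>1. ?s 3 c = s 3 c) \<and> ?s 1 0 = 3 + 2 * n \<and>
        output_of ?s = [s 3 5, s 3 12, s 3 6] @ indicator_list n S @ indicator_list n S"
      using R by (simp add: F_def)
  qed (use of_bool_less_L in auto)
  show ?thesis
    unfolding output_prog_def
    by (rule reaches_Seq, rule h1,
        rule reaches_Seq, rule h2, assumption, assumption,
        rule reaches_Seq, rule h3, assumption, assumption,
        rule reaches_Seq, rule h4, assumption, assumption,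
        rule reaches_Seq, rule h5, assumption, assumption,
        rule h6, assumption, assumption)
qed

definition env :: "nat \<Rightarrow> store \<Rightarrow> bool" where
  "env z s \<longleftrightarrow> s 0 = inp \<and> s 3 1 = common_den \<and> s 3 2 = candidates \<and> s 3 3 = z"

lemma reaches_body:
  assumes b: "bounded L s" and s: "env z s" and z: "z < candidates"
  shows "reaches L (Suc n * L) (body w) s (\<lambda>s'. env (Suc z) s' \<and>
    (if good z then output_of s' = answer z \<and> s' 1 0 = 3 + 2 * n else s' 1 = s 1))"
proof -
  \<comment> \<open>\<open>R\<close>, \<open>R'\<close> and \<open>R''\<close> are the assertions
    after decoding, after summation and after the conditional output.\<close>
  define R where "R s' \<longleftrightarrow> env z s' \<and> s' 1 = s 1 \<and>
    s' 3 5 = row_of z \<and> s' 3 6 = t_of z \<and> s' 3 7 = j_of z \<and> s' 3 8 = p_of z \<and> s' 3 9 = p'_of z \<and>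
    (\<forall>i<n. s' 2 i = of_bool (i \<in> chosen z))" for s' :: store
  define R' where "R' s' \<longleftrightarrow> R s' \<and> s' 3 10 = card (chosen z) \<and> s' 3 11 = sum (A (row_of z)) (chosen z) \<and>
    s' 3 12 = card (low z) \<and> s' 3 13 = card (high z) \<and> s' 3 14 = sum (A (row_of z)) (low z) \<and>
    s' 3 15 = sum (A (row_of z)) (high z) \<and> s' 3 16 = sum scaled (chosen z)" for s' :: store
  define R'' where "R'' s' \<longleftrightarrow> env z s' \<and>
    (if good z then output_of s' = answer z \<and> s' 1 0 = 3 + 2 * n else s' 1 = s 1)" for s' :: store
  note L = L_ge(2)
  have LX: "L \<le> Suc n * L" by simp
  have h1: "reaches L (Suc n * L) (prepare w) s R"
    by (rule reaches_mono[OF reaches_prepare[OF b _ _ z] order_refl]) (use s in \<open>auto simp: env_def R_def\<close>)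
  have h2: "reaches L (Suc n * L) evaluate s' R'" if "bounded L s'" "R s'" for s'
    by (rule reaches_mono[OF reaches_evaluate[OF that(1) z] order_refl])
      (use that(2) in \<open>auto simp: env_def R_def R'_def frame_def\<close>)
  have h3: "reaches L (Suc n * L) (Cond checkE output_prog Skip) s' R''"
    if b': "bounded L s'" and r: "R' s'" for s'
  proof -
    have lt: "row_of z < m" "t_of z < n" using candidates_pos[OF z] by (simp_all add: row_of_def t_of_def)
    have "val s' checkE = of_bool (good z)"
      using r lt by (simp add: R'_def R_def env_def checkE_def val_simps good_def)
    moreover have "reaches L (Suc n * L) output_prog s' R''" if "good z"
      by (rule reaches_mono[OF reaches_output[OF b', of "chosen z"] order_refl])
        (use r that in \<open>auto simp: R'_def R_def R''_def env_def answer_def\<close>)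
    moreover have "reaches L (Suc n * L) Skip s' R''" if "\<not> good z"
      using r that b' L by (intro reaches_Skip) (auto simp: R'_def R_def R''_def)
    ultimately show ?thesis using b' L LX by (intro reaches_Cond) auto
  qed
  have h4: "reaches L (Suc n * L) (Assign 3 (Num 3) (Add (var 3) (Num 1))) s' (\<lambda>s'. env (Suc z) s' \<and>
      (if good z then output_of s' = answer z \<and> s' 1 0 = 3 + 2 * n else s' 1 = s 1))"
    if "bounded L s'" "R'' s'" for s'
    using L LX that z candidates_less
    by (intro reaches_Assign) (auto simp: R''_def env_def output_of_def)
  show ?thesis
    unfolding body_def
    by (rule reaches_Seq, rule h1,
        rule reaches_Seq, rule h2, assumption, assumption,
        rule reaches_Seq, rule h3, assumption, assumption,
        rule h4, assumption, assumption)
qed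

lemma reaches_init:
  assumes b: "bounded L s" and s: "s 0 = inp" "s 3 3 = 0"
  shows "reaches L (Suc n * L) (init w) s (\<lambda>s'. env 0 s' \<and> s' 1 = s 1)"
proof -
  note L = L_ge(2)
  have LX: "L \<le> Suc n * L" by simp
  have common_less: "common_den < 2 ^ L"
  proof -
    have "common_den \<le> 2 ^ (1 * N)" using prod_den_le by (simp add: common_den_def)
    also have "\<dots> < 2 ^ (5 * N)" using N_ge by (intro power_strict_increasing) auto
    also have "\<dots> \<le> 2 ^ L" by (rule two_power_le) simp
    finally show ?thesis .
  qed
  define I where "I i s' \<longleftrightarrow> s' 0 = inp \<and> s' 1 = s 1 \<and> s' 3 3 = 0 \<and> s' 3 1 = prod den {..<i} \<and> s' 3 0 = i"
    for i and s' :: store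
  have one: "(1::nat) < 2 ^ L" using of_bool_less_L[of True] by simp
  have h1: "reaches L (Suc n * L) (Assign 3 (Num 1) (Num 1)) s (\<lambda>s'. s' 0 = inp \<and> s' 1 = s 1 \<and> s' 3 3 = 0 \<and> s' 3 1 = 1)"
    using L LX b s one by (intro reaches_Assign) auto
  have h2: "reaches L (Suc n * L) (for_loop nE (Assign 3 (Num 1) (Mul (var 1) (denE (var 0))))) s' (I n)"
    if b': "bounded L s'" and R: "s' 0 = inp \<and> s' 1 = s 1 \<and> s' 3 3 = 0 \<and> s' 3 1 = 1" for s'
  proof (rule reaches_for_loop[where I = I and n = n, OF L order_refl n_less_L b'])
    show "I 0 (s'(3 := (s' 3)(0 := 0)))" using R by (simp add: I_def)
    show "s' 3 0 = i \<and> val s' nE = n" if "I i s'" for i s'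
      using that by (simp add: I_def val_nE)
  next
    fix i s' assume i: "i < n" "bounded L s'" "I i s'"
    have "prod den {..<i} * den i = prod den {..<Suc i}" by simp
    \<comment> \<open>A partial product divides the full one, which is positive; so the accumulator
      never exceeds the common denominator.\<close>
    also have "\<dots> \<le> prod den {..<n}"
    proof (rule dvd_imp_le)
      show "prod den {..<Suc i} dvd prod den {..<n}"
        using i(1) by (intro prod_dvd_prod_subset) auto
      show "0 < prod den {..<n}" using den_pos by (intro prod_pos) auto
    qed
    finally have "prod den {..<i} * den i < 2 ^ L" using common_less by (simp add: common_den_def)
    then show "reaches L L (Assign 3 (Num 1) (Mul (var 1) (denE (var 0)))) s'
        (\<lambda>s'. s' 3 0 = i \<and> I (Suc i) (s'(3 := (s' 3)(0 := Suc i))))"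
      using L i by (intro reaches_Assign) (auto simp: I_def val_denE)
  qed
  have h3: "reaches L (Suc n * L) (Assign 3 (Num 2) (Mul mE (Mul (powE nE 4) (powE (Mul (Num 2) nE) w)))) s'
      (\<lambda>s'. env 0 s' \<and> s' 1 = s 1)" if "bounded L s'" "I n s'" for s'
    using L LX that candidates_less
    by (intro reaches_Assign) (auto simp: I_def env_def common_den_def candidates_def val_simps)
  show ?thesis
    unfolding init_def
    by (rule reaches_Seq, rule h1,
        rule reaches_Seq, rule h2, assumption, assumption,
        rule h3, assumption, assumption)
qed

lemma reaches_separator:
  assumes b: "bounded L s" and s: "s 0 = inp" "s 3 3 = 0" "s 1 0 = 0"
  shows "reaches L (Suc candidates * (Suc n * L)) (separator w) s
    (\<lambda>s'. s' 1 0 \<le> 3 + 2 * n \<and>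
      (if \<exists>z<candidates. good z then \<exists>z<candidates. good z \<and> output_of s' = answer z else output_of s' = []))"
proof -
  \<comment> \<open>After \<open>z\<close> candidates, the output array holds the answer of a good
    one among them, or the empty list if there is none. The bound on its length cell later bounds
    the size of the output, which is charged as well.\<close>
  define I where "I z s' \<longleftrightarrow> env z s' \<and> s' 1 0 \<le> 3 + 2 * n \<and>
    (if \<exists>z'<z. good z' then \<exists>z'<z. good z' \<and> output_of s' = answer z' else s' 1 0 = 0)"
    for z and s' :: store
  note L = L_ge(2)
  have LX: "L \<le> Suc n * L" by simp
  have XY: "Suc n * L \<le> Suc candidates * (Suc n * L)" by simp
  have h1: "reaches L (Suc candidates * (Suc n * L)) (init w) s (I 0)"
    by (rule reaches_mono[OF reaches_init[OF b s(1,2)] XY]) (use s in \<open>auto simp: I_def\<close>)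
  have h2: "reaches L (Suc candidates * (Suc n * L)) (While (Sub (var 2) (var 3)) (body w)) s' (I candidates)"
    if b': "bounded L s'" and "I 0 s'" for s'
  proof (rule reaches_While[where I = I and n = candidates, OF L LX b' \<open>I 0 s'\<close>])
    fix z s'' assume z: "z < candidates" "bounded L s''" "I z s''"
    have e: "env z s''" using z(3) by (simp add: I_def)
    have "reaches L (Suc n * L) (body w) s'' (I (Suc z))"
    proof (rule reaches_mono[OF reaches_body[OF z(2) e z(1)] order_refl])
      fix s3 assume r: "env (Suc z) s3 \<and>
        (if good z then output_of s3 = answer z \<and> s3 1 0 = 3 + 2 * n else s3 1 = s'' 1)"
      show "I (Suc z) s3"
      proof (cases "good z")
        case True
        then show ?thesis using r by (auto simp: I_def)
      next
        case False
        then have eq: "output_of s3 = output_of s''" "s3 1 0 = s'' 1 0"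
          using r by (simp_all add: output_of_def)
        show ?thesis
        proof (cases "\<exists>z'<z. good z'")
          case True
          then obtain z' where "z' < Suc z" "good z'" "output_of s3 = answer z'"
            using z(3) eq less_SucI by (metis I_def)
          then have "\<exists>z'<Suc z. good z' \<and> output_of s3 = answer z'" "\<exists>z'<Suc z. good z'" by blast+
          then show ?thesis using r z(3) eq by (simp add: I_def)
        next
          case none: False
          then have "\<not> (\<exists>z'<Suc z. good z')" using False by (metis less_Suc_eq)
          moreover have "s'' 1 0 = 0" using z(3) none by (simp only: I_def if_False)
          ultimately show ?thesis using r eq unfolding I_def by (simp only: if_False) simp
        qed
      qed
    qed
    then show "val s'' (Sub (var 2) (var 3)) \<noteq> 0 \<and> reaches L (Suc n * L) (body w) s'' (I (Suc z))"
      using e z(1) by (simp add: env_def)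
  next
    fix s'' assume "I candidates s''"
    then show "val s'' (Sub (var 2) (var 3)) = 0" by (simp add: I_def env_def)
  qed
  have "reaches L (Suc candidates * (Suc n * L)) (separator w) s (I candidates)"
    unfolding separator_def
    by (rule reaches_Seq, rule h1,
        rule h2, assumption, assumption)
  then show ?thesis
  proof (rule reaches_mono[OF _ order_refl])
    fix s' assume i: "I candidates s'"
    show "s' 1 0 \<le> 3 + 2 * n \<and>
      (if \<exists>z<candidates. good z then \<exists>z<candidates. good z \<and> output_of s' = answer z else output_of s' = [])"
    proof (cases "\<exists>z<candidates. good z")
      case True
      with i show ?thesis by (simp only: I_def if_True)
    next
      case False
      with i have "s' 1 0 = 0" by (simp only: I_def if_False)
      moreover from this have "output_of s' = []" by (simp add: output_of_def)
      ultimately show ?thesis using False by (simp only: if_False) simp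
    qed
  qed
qed

end

section \<open>Correctness and polynomial running time\<close>

text \<open>A subset with \<open>k - 1\<close> elements extends by some \<open>i\<close> in
  \<open>S\<close> to one with \<open>k\<close> elements; minimality with respect to
  \<open>i\<close> is then the upper bound in \<open>config\<close>. Conversely, removing
  \<open>t\<close> from a cover \<open>Q \<union> {t}\<close> leaves a subset of \<open>S\<close>,
  which weighs at most \<open>b\<close>.\<close>

lemma (in row_point) configuration_iff_config:
  assumes v: "dim_vec v = n" "\<And>i. i < n \<Longrightarrow> v $ i = a i"
  shows "configuration v b k S t \<longleftrightarrow> config k S t"
proof
  assume c: "configuration v b k S t"
  then have S: "S \<subseteq> {..<n}" "t < n" "t \<notin> S" "2 \<le> k" "k \<le> card S"
    by (auto simp: configuration_def v(1))
  have sum_v: "(\<Sum>i\<in>Q. v $ i) = sum a Q" if "Q \<subseteq> {..<n}" for Q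
    using that v(2) by (intro sum.cong) auto
  have finS: "finite S" using S(1) by (rule finite_sub)
  have mc: "minimal_cover v b (Q \<union> {t})" if "Q \<subseteq> S" "card Q = k" for Q
    using c that by (auto simp: configuration_def)
  show "config k S t"
    unfolding config_def
  proof (intro conjI allI impI)
    show "sum a S \<le> b" using c sum_v[OF S(1)] by (simp add: configuration_def)
  next
    fix Q assume Q: "Q \<subseteq> S" "card Q = k"
    have Qn: "Q \<union> {t} \<subseteq> {..<n}" "t \<notin> Q" using Q S by auto
    then show "b < a t + sum a Q"
      using mc[OF Q] sum_v[OF Qn(1)] finite_subset[OF Q(1) finS]
      by (simp add: minimal_cover_def cover_def)
  next
    fix Q assume Q: "Q \<subseteq> S" "card Q = k - 1"
    have finQ: "finite Q" using Q(1) finS by (rule finite_subset)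
    have "Q \<noteq> S" using Q S by auto
    then obtain i where i: "i \<in> S" "i \<notin> Q" using Q by auto
    have "minimal_cover v b (insert i Q \<union> {t})"
      using i Q S(4) finQ by (intro mc) auto
    then have "(\<Sum>l\<in>(insert i Q \<union> {t}) - {i}. v $ l) \<le> b" by (simp add: minimal_cover_def)
    moreover have "(insert i Q \<union> {t}) - {i} = insert t Q" using i S(3) by auto
    moreover have "insert t Q \<subseteq> {..<n}" "t \<notin> Q" using Q S by auto
    ultimately show "a t + sum a Q \<le> b" using sum_v[of "insert t Q"] finQ by simp
  qed (use S in auto)
next
  assume c: "config k S t"
  then have S: "S \<subseteq> {..<n}" "t < n" "t \<notin> S" "2 \<le> k" "k \<le> card S" "sum a S \<le> b"
    by (auto simp: config_def)
  have sum_v: "(\<Sum>i\<in>Q. v $ i) = sum a Q" if "Q \<subseteq> {..<n}" for Q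
    using that v(2) by (intro sum.cong) auto
  have finS: "finite S" using S(1) by (rule finite_sub)
  have "minimal_cover v b (Q \<union> {t})" if Q: "Q \<subseteq> S" "card Q = k" for Q
  proof -
    have finQ: "finite Q" using Q(1) finS by (rule finite_subset)
    have Qn: "insert t Q \<subseteq> {..<n}" "t \<notin> Q" using Q S by auto
    have "b < a t + sum a Q" using c Q by (simp add: config_def)
    then have "cover v b (Q \<union> {t})"
      using Qn finQ sum_v[OF Qn(1)] by (simp add: cover_def v(1))
    moreover have "(\<Sum>i\<in>(Q \<union> {t}) - {j}. v $ i) \<le> b" if j: "j \<in> Q \<union> {t}" for j
    proof (cases "j = t")
      case True
      then have "(Q \<union> {t}) - {j} = Q" using Qn(2) by auto
      moreover have "sum a Q \<le> sum a S" using Q(1) finS by (intro sum_mono2) auto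
      ultimately show ?thesis using sum_v[of Q] Qn(1) S(6) by simp
    next
      case False
      then have jQ: "j \<in> Q" using j by simp
      have eq: "(Q \<union> {t}) - {j} = insert t (Q - {j})" using False by auto
      have sub: "Q - {j} \<subseteq> S" and cd: "card (Q - {j}) = k - 1" using Q jQ finQ by auto
      have "a t + sum a (Q - {j}) \<le> b" using c sub cd by (simp add: config_def)
      moreover have "insert t (Q - {j}) \<subseteq> {..<n}" using Qn(1) by auto
      ultimately show ?thesis unfolding eq using sum_v[of "insert t (Q - {j})"] finQ Qn(2) by simp
    qed
    ultimately show ?thesis by (simp add: minimal_cover_def)
  qed
  then show "configuration v b k S t"
    using S sum_v[OF S(1)] by (auto simp: configuration_def v(1))
qed

section \<open>Exactness of the test and completeness of the search\<close>

locale encoded_point = encoded_instance +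
  assumes feasible: "r < m \<Longrightarrow> (\<Sum>i<n. real (A r i) * (real (num i) / real (den i))) \<le> real (d r)"
begin

definition x :: "nat \<Rightarrow> real" where
  "x i = real (num i) / real (den i)"

lemma is_row_point: "row_point n (d r) (A r) x" if "r < m"
proof
  show "0 \<le> x i \<and> x i \<le> 1" if "i < n" for i
    using num_le_den[OF that] den_pos[OF that] by (simp add: x_def)
  show "(\<Sum>i<n. real (A r i) * x i) \<le> real (d r)"
    using feasible[OF \<open>r < m\<close>] by (simp add: x_def)
qed

text \<open>Each denominator divides the common one, so the integer division in
  \<open>scaled\<close> is exact.\<close>

lemma real_scaled: "real (scaled i) = x i * real common_den" if "i < n"
proof -
  have "den i dvd common_den" unfolding common_den_def using that by (intro dvd_prodI) auto
  then show ?thesis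
    using den_pos[OF that] by (auto simp: scaled_def x_def real_of_nat_div)
qed

lemma common_den_pos: "0 < common_den"
  unfolding common_den_def using den_pos by (intro prod_pos) auto

lemma good_iff_accepts:
  assumes z: "z < candidates"
  shows "good z \<longleftrightarrow>
    row_point.accepts n (d (row_of z)) (A (row_of z)) x (p_of z) (p'_of z) (t_of z) (chosen z)"
proof -
  let ?r = "row_of z"
  have r: "?r < m" and t: "t_of z < n" using candidates_pos[OF z] by (simp_all add: row_of_def t_of_def)
  interpret R: row_point n "d ?r" "A ?r" x by (rule is_row_point[OF r])
  have key: "R.key = rank_key ?r" by (simp add: fun_eq_iff R.key_def rank_key_def)
  have fin: "finite (chosen z)" using chosen_subset by (rule finite_subset) simp
  have le: "card (low z) \<le> card (chosen z)" using fin by (intro card_mono) (auto simp: low_def)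
  have "real (\<Sum>i\<in>chosen z. scaled i) = sum x (chosen z) * real common_den"
    unfolding sum_distrib_right of_nat_sum using chosen_subset[of z] by (intro sum.cong) (auto simp: real_scaled)
  \<comment> \<open>\<open>low z\<close> is a subset of \<open>chosen z\<close>, so the truncated
    subtraction agrees with the real one.\<close>
  moreover have factor: "real (card (chosen z) + 1 - card (low z)) = real (card (chosen z)) - real (card (low z)) + 1"
    using le by (simp add: of_nat_diff)
  ultimately have "real ((card (chosen z) + 1 - card (low z)) * scaled (t_of z) + sum scaled (chosen z)) =
      ((real (card (chosen z)) - real (card (low z)) + 1) * x (t_of z) + sum x (chosen z)) * real common_den"
    using factor by (simp only: of_nat_add of_nat_mult real_scaled[OF t]) (simp add: algebra_simps)
  then have "card (chosen z) * common_den <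
      (card (chosen z) + 1 - card (low z)) * scaled (t_of z) + sum scaled (chosen z) \<longleftrightarrow>
    real (card (chosen z)) * real common_den <
      ((real (card (chosen z)) - real (card (low z)) + 1) * x (t_of z) + sum x (chosen z)) * real common_den"
    by (metis of_nat_less_iff of_nat_mult)
  also have "\<dots> \<longleftrightarrow> real (card (chosen z)) <
      (real (card (chosen z)) - real (card (low z)) + 1) * x (t_of z) + sum x (chosen z)"
    using common_den_pos by (intro mult_less_cancel_right_pos) simp
  finally show ?thesis
    unfolding R.accepts_def good_def key low_def high_def Let_def by simp
qed

lemma good_imp_violating:
  assumes z: "z < candidates" and g: "good z"
  shows "row_point.violating n (d (row_of z)) (A (row_of z)) x (card (low z)) (chosen z) (t_of z)"
proof -
  let ?r = "row_of z"
  have r: "?r < m" and t: "t_of z < n" using candidates_pos[OF z] by (simp_all add: row_of_def t_of_def)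
  interpret R: row_point n "d ?r" "A ?r" x by (rule is_row_point[OF r])
  have key: "R.key = rank_key ?r" by (simp add: fun_eq_iff R.key_def rank_key_def)
  have "t_of z \<notin> chosen z" by (simp add: chosen_def cells_def)
  then have "R.violating (card {i \<in> chosen z. R.key i \<le> R.key (p_of z)}) (chosen z) (t_of z)"
    using g good_iff_accepts[OF z] chosen_subset t by (intro R.accepts_imp_violating) auto
  then show ?thesis by (simp add: key low_def)
qed

text \<open>\<open>violating_near_base\<close> replaces the given inequality by one whose set is
  described by \<open>t\<close>, \<open>j\<close> and at most \<open>w\<close> corrections. These
  data, the row and two thresholds for the test are the digits of a candidate number.\<close>

lemma violating_imp_good:
  assumes r: "r < m" and v0: "row_point.violating n (d r) (A r) x k0 S0 t0"
    and few: "card {i. i < n \<and> 0 < x i \<and> x i < 1} \<le> \<alpha>" and w: "\<alpha> * \<alpha> + 2 * \<alpha> \<le> w"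
  shows "\<exists>z<candidates. good z"
proof -
  interpret R: row_point n "d r" "A r" x by (rule is_row_point[OF r])
  obtain k S t j X where j: "j < n" and v: "R.violating k S t" and X: "finite X" "X \<subseteq> {..<n}"
      "card X \<le> card R.fracs * card R.fracs + 2 * card R.fracs"
    and SX: "\<And>i. i < n \<Longrightarrow> i \<noteq> t \<Longrightarrow> i \<notin> X \<Longrightarrow> i \<in> S \<longleftrightarrow> i \<in> R.base t j"
    using R.violating_near_base[OF v0] by blast
  have S: "S \<subseteq> {..<n}" "t < n" "t \<notin> S" using v by (auto simp: R.violating_def R.config_def)
  obtain p p' where p: "p < n" "p' < n" "R.accepts p p' t S" using R.violating_imp_accepts[OF v] .
  have f: "card R.fracs \<le> \<alpha>" using few by (simp add: R.fracs_def)
  have "card R.fracs * card R.fracs \<le> \<alpha> * \<alpha>" using f by (intro mult_le_mono)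
  then have Xw: "card X \<le> w" using X(3) f w by linarith
  \<comment> \<open>The list of corrections is padded with \<open>t\<close> to length
    \<open>w\<close>; the cell of \<open>t\<close> is set to 0 afterwards in any case.\<close>
  define vs where "vs = sorted_list_of_set X @ replicate (w - card X) t"
  have vs: "length vs = w" "set vs \<subseteq> {..<n}" "X \<subseteq> set vs" "set vs \<subseteq> insert t X"
    using X S(2) Xw by (auto simp: vs_def)
  have key: "R.key = rank_key r" by (simp add: fun_eq_iff R.key_def rank_key_def)
  have le_1: "of_bool (i \<in> S) \<le> (1::nat)" for i by simp
  obtain y where y: "y < (2 * n) ^ w"
    and ed: "\<And>i. edit n w y (\<lambda>i. of_bool (i \<in> R.base t j)) i =
      (if i \<in> set vs then of_bool (i \<in> S) else of_bool (i \<in> R.base t j))"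
    using edit_surj[where f = "\<lambda>i. of_bool (i \<in> S)" and h = "\<lambda>i. of_bool (i \<in> R.base t j)",
        OF vs(1,2) le_1] by blast
  define z where "z = r + m * (t + n * (j + n * (p + n * (p' + n * y))))"
  have z_of: "row_of z = r" "t_of z = t" "j_of z = j" "p_of z = p" "p'_of z = p'" "code_of z = y"
    using r S(2) j p(1,2)
    by (simp_all add: z_def row_of_def t_of_def j_of_def p_of_def p'_of_def code_of_def)
  \<comment> \<open>Bounds a mixed-radix number by the product of the radices, one digit at a
    time.\<close>
  have digit: "u + l * q < l * M" if "u < l" "q < M" for u l q M :: nat
  proof -
    have "u + l * q < l * Suc q" using that(1) by simp
    also have "\<dots> \<le> l * M" using that(2) by (intro mult_le_mono2) simp
    finally show ?thesis .
  qed
  have "z < m * (n * (n * (n * (n * (2 * n) ^ w))))"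
    unfolding z_def using r S(2) j p(1,2) y by (intro digit)
  then have z: "z < candidates" by (simp add: candidates_def power4_eq_xxxx mult.assoc)
  have base: "base_of z = R.base t j"
    using den_pos by (auto simp: base_of_def R.base_def R.ones_def z_of key x_def)
  have "cells z i = of_bool (i \<in> S)" if "i < n" for i
  proof (cases "i = t")
    case True
    then show ?thesis using S(3) by (simp add: cells_def z_of)
  next
    case False
    then show ?thesis using SX[OF that False] vs(3) ed by (auto simp: cells_def z_of base)
  qed
  then have "chosen z = S" using S(1) by (auto simp: chosen_def of_bool_def split: if_splits)
  then have "good z" using good_iff_accepts[OF z] p(3) by (simp add: z_of)
  with z show ?thesis by blast
qed

end

section \<open>Positions and sizes in encodings\<close>

lemma length_concat_rows: "length (concat (map (\<lambda>r. map (f r) [0..<n]) [0..<m])) = m * n"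
  by (induction m) auto

lemma nth_concat_rows:
  assumes "r < m" "i < n"
  shows "concat (map (\<lambda>r. map (f r) [0..<n]) [0..<m]) ! (r * n + i) = f r i"
  using assms(1)
proof (induction m)
  case (Suc m)
  show ?case
  proof (cases "r = m")
    case True
    then show ?thesis using assms(2) by (simp add: nth_append length_concat_rows)
  next
    case False
    then have r: "r < m" using Suc.prems by simp
    have "r * n + i < Suc r * n" using assms(2) by simp
    also have "\<dots> \<le> m * n" using r by (intro mult_le_mono1) simp
    finally show ?thesis using Suc.IH[OF r] by (simp add: nth_append length_concat_rows)
  qed
qed simp

lemma length_le_word_size: "length ws \<le> word_size ws"
  by (induction ws) (auto simp: word_size_def bit_length_def)

lemma mem_less_two_power_word_size: "v \<in> set ws \<Longrightarrow> v < 2 ^ word_size ws"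
proof -
  assume "v \<in> set ws"
  then have "bit_length v \<le> word_size ws"
    unfolding word_size_def by (intro member_le_sum_list) auto
  then have "(2::nat) ^ bit_length v \<le> 2 ^ word_size ws" by (intro power_increasing) auto
  with less_two_power_bit_length[of v] show ?thesis by linarith
qed

lemma word_size_append: "word_size (us @ vs) = word_size us + word_size vs"
  by (simp add: word_size_def)

text \<open>Bit lengths add up under multiplication, so the product of all denominators has a size
  linear in that of the input.\<close>

lemma prod_le_two_power_word_size:
  "prod f {..<n} \<le> 2 ^ word_size (map f [0..<n])"
proof -
  have "prod f {..<n} \<le> (\<Prod>i<n. 2 ^ bit_length (f i))"
    using less_two_power_bit_length by (intro prod_mono) (auto intro: less_imp_le)
  also have "\<dots> = 2 ^ (\<Sum>i<n. bit_length (f i))" by (simp add: power_sum)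
  also have "(\<Sum>i<n. bit_length (f i)) = word_size (map f [0..<n])"
    by (simp add: word_size_def sum_list_sum_nth atLeast0LessThan)
  finally show ?thesis .
qed

lemma initial_store_0_Suc: "i < length ws \<Longrightarrow> initial_store ws 0 (Suc i) = ws ! i"
  by (simp add: initial_store_def)

lemma bounded_initial_store:
  "bounded (word_size ws) (initial_store ws)"
  unfolding bounded_def
proof (intro allI)
  fix r i
  have "length ws < 2 ^ word_size ws"
    using length_le_word_size[of ws] less_exp[of "word_size ws"] by linarith
  moreover have "(length ws # ws) ! i < 2 ^ word_size ws" if "i \<le> length ws"
    using that calculation mem_less_two_power_word_size[of "ws ! (i - 1)" ws]
    by (cases i) auto
  ultimately show "initial_store ws r i < 2 ^ word_size ws"
    by (auto simp: initial_store_def)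
qed

lemma bounded_mono: "bounded L s \<Longrightarrow> L \<le> L' \<Longrightarrow> bounded L' s"
  unfolding bounded_def by (meson less_le_trans one_le_numeral power_increasing)

lemma word_size_output_le:
  assumes "bounded L s" "1 \<le> L"
  shows "word_size (output_of s) \<le> s 1 0 * L"
proof -
  have "bit_length (s 1 (Suc i)) \<le> L" for i
    using assms by (intro bit_length_le) (auto simp: bounded_def)
  then have "word_size (output_of s) \<le> sum_list (map (\<lambda>_. L) [0..<s 1 0])"
    unfolding word_size_def output_of_def map_map comp_def by (intro sum_list_mono) auto
  then show ?thesis by (simp add: sum_list_triv)
qed

section \<open>The encoding of rational solutions and the run on an input\<close>

definition numerator :: "config_sp \<Rightarrow> nat \<Rightarrow> nat" where
  "numerator P i = nat (fst (quotient_of (solution P $ i)))"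

definition denominator :: "config_sp \<Rightarrow> nat \<Rightarrow> nat" where
  "denominator P i = nat (snd (quotient_of (solution P $ i)))"

lemma denominator_pos: "0 < denominator P i"
  by (simp add: denominator_def quotient_of_denom_pos')

lemma solution_eq_quotient:
  assumes "0 \<le> solution P $ i"
  shows "real_of_rat (solution P $ i) = real (numerator P i) / real (denominator P i)"
proof -
  obtain p q where pq: "quotient_of (solution P $ i) = (p, q)" by (cases "quotient_of (solution P $ i)")
  have q: "0 < q" using quotient_of_denom_pos[OF pq] .
  have eq: "solution P $ i = of_int p / of_int q" using quotient_of_div[OF pq] .
  then have "0 \<le> p" using assms q by (simp add: zero_le_divide_iff)
  moreover have "real_of_rat (solution P $ i) = real_of_int p / real_of_int q"
    by (simp add: eq of_rat_divide)
  ultimately show ?thesis using q by (simp add: numerator_def denominator_def pq)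
qed

context
  fixes P :: config_sp
  assumes P: "config_sp_input P"
begin

private abbreviation "m \<equiv> dim_row (matrix P)"
private abbreviation "n \<equiv> dim_col (matrix P)"

lemma dims: "dim_vec (rhs P) = m" "dim_vec (objective P) = n" "dim_vec (solution P) = n"
  using P by (auto simp: config_sp_input_def lp_optimal_def lp_feasible_def real_solution_def)

lemma solution_range: "0 \<le> solution P $ i \<and> solution P $ i \<le> 1" if "i < n"
proof -
  have "0 \<le> real_of_rat (solution P $ i) \<and> real_of_rat (solution P $ i) \<le> 1"
    using P that dims
    by (auto simp: config_sp_input_def lp_optimal_def lp_feasible_def real_solution_def)
  then show ?thesis by simp
qed

lemma real_solution_eq: "real_solution P $ i = real (numerator P i) / real (denominator P i)" if "i < n"
  using solution_eq_quotient[of P i] solution_range[OF that] that dims by (simp add: real_solution_def)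

lemma encode_input_eq:
  "encode_input P = [m, n] @ concat (map (\<lambda>r. map (\<lambda>i. matrix P $$ (r, i)) [0..<n]) [0..<m]) @
     map (\<lambda>r. rhs P $ r) [0..<m] @ map (\<lambda>i. objective P $ i) [0..<n] @
     map (numerator P) [0..<n] @ map (denominator P) [0..<n]"
  by (simp add: encode_input_def mat_to_list_def list_of_vec_map dims numerator_def denominator_def comp_def)

lemma length_encode_input: "length (encode_input P) = 2 + (m * n + (m + 3 * n))"
  by (simp add: encode_input_eq length_concat_rows)

lemma feasible_row:
  assumes "r < m"
  shows "(\<Sum>i<n. real (matrix P $$ (r, i)) * (real (numerator P i) / real (denominator P i))) \<le> real (rhs P $ r)"
proof -
  have "map_mat real (matrix P) *\<^sub>v real_solution P \<le> map_vec real (rhs P)"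
    using P by (simp add: config_sp_input_def lp_optimal_def lp_feasible_def)
  moreover have "r < dim_vec (map_vec real (rhs P))" using assms dims by simp
  ultimately have "(map_mat real (matrix P) *\<^sub>v real_solution P) $ r \<le> map_vec real (rhs P) $ r"
    unfolding less_eq_vec_def by blast
  moreover have "dim_vec (real_solution P) = n" using dims by (simp add: real_solution_def)
  ultimately show ?thesis
    using assms dims by (simp add: scalar_prod_def atLeast0LessThan real_solution_eq)
qed

lemma encoded_point_input:
  assumes N: "N = word_size (encode_input P)" and L: "L = (2 * w + 5) * N"
  shows "encoded_point m n w N L (\<lambda>r i. matrix P $$ (r, i)) (\<lambda>r. rhs P $ r)
    (numerator P) (denominator P) (initial_store (encode_input P) 0)"
proof unfold_locales
  let ?inp = "initial_store (encode_input P) 0"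
  \<comment> \<open>The length in cell \<open>0\<close> shifts all entries by one, and the two
    dimensions precede the matrix.\<close>
  have inp: "?inp (3 + q) = encode_input P ! (2 + q)" if "2 + q < length (encode_input P)" for q
    using initial_store_0_Suc[OF that] by (simp add: numeral_3_eq_3)
  show "?inp 1 = m" "?inp 2 = n"
    using initial_store_0_Suc[of 0 "encode_input P"] initial_store_0_Suc[of 1 "encode_input P"]
    by (simp_all add: encode_input_eq numeral_2_eq_2)
  show "?inp (3 + (r * n + i)) = matrix P $$ (r, i)" if "r < m" "i < n" for r i
  proof -
    have "r * n + i < Suc r * n" using that(2) by simp
    also have "\<dots> \<le> m * n" using that(1) by (intro mult_le_mono1) simp
    finally have lt: "r * n + i < m * n" .
    then have "?inp (3 + (r * n + i)) = encode_input P ! (2 + (r * n + i))"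
      by (intro inp) (simp add: length_encode_input)
    also have "\<dots> = matrix P $$ (r, i)"
      using lt nth_concat_rows[OF that, of "\<lambda>r i. matrix P $$ (r, i)"]
      by (simp add: encode_input_eq nth_append length_concat_rows)
    finally show ?thesis .
  qed
  show "?inp (3 + (m * n + r)) = rhs P $ r" if "r < m" for r
    using that by (subst inp) (simp_all add: length_encode_input encode_input_eq nth_append length_concat_rows)
  show "?inp (3 + (m * n + (m + n) + i)) = numerator P i" if "i < n" for i
    using that by (subst inp) (simp_all add: length_encode_input encode_input_eq nth_append length_concat_rows)
  show "?inp (3 + (m * n + (m + 2 * n) + i)) = denominator P i" if "i < n" for i
    using that by (subst inp) (simp_all add: length_encode_input encode_input_eq nth_append length_concat_rows)
  show "?inp i < 2 ^ N" for i
    using bounded_initial_store[of "encode_input P"] by (simp add: bounded_def N)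
  show "numerator P i \<le> denominator P i" if "i < n" for i
  proof -
    have "real_of_rat (solution P $ i) \<le> 1" using solution_range[OF that] by simp
    then have "real (numerator P i) / real (denominator P i) \<le> 1"
      using solution_eq_quotient[of P i] solution_range[OF that] by simp
    then show ?thesis using denominator_pos[of P i] by simp
  qed
  show "0 < denominator P i" for i by (rule denominator_pos)
  show "prod (denominator P) {..<n} \<le> 2 ^ N"
  proof -
    have "word_size (map (denominator P) [0..<n]) \<le> N"
      unfolding N encode_input_eq word_size_append by simp
    then have "(2::nat) ^ word_size (map (denominator P) [0..<n]) \<le> 2 ^ N"
      by (intro power_increasing) auto
    with prod_le_two_power_word_size[of "denominator P" n] show ?thesis by linarith
  qed
  show "2 \<le> N" using length_le_word_size[of "encode_input P"] by (simp add: N length_encode_input)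
  show "L = (2 * w + 5) * N" by (rule L)
  show "(\<Sum>i<n. real (matrix P $$ (r, i)) * (real (numerator P i) / real (denominator P i))) \<le> real (rhs P $ r)"
    if "r < m" for r using that by (rule feasible_row)
qed

lemma separator_run:
  assumes few: "card (fractional P) \<le> \<alpha>" and w: "w = \<alpha> * \<alpha> + 2 * \<alpha>"
    and N: "N = word_size (encode_input P)" and L: "L = (2 * w + 5) * N"
  shows "\<exists>t s. exec (separator w) (initial_store (encode_input P)) t s \<and>
    t + word_size (output_of s) \<le>
      prog_weight (separator w) * (Suc (m * (n ^ 4 * (2 * n) ^ w)) * (Suc n * L)) + (3 + 2 * n) * L \<and>
    separates P (output_of s)"
proof -
  interpret E: encoded_point m n w N L "\<lambda>r i. matrix P $$ (r, i)" "\<lambda>r. rhs P $ r"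
    "numerator P" "denominator P" "initial_store (encode_input P) 0"
    using N L by (rule encoded_point_input)
  have "bounded L (initial_store (encode_input P))"
    by (rule bounded_mono[OF bounded_initial_store]) (simp add: L N)
  then have "reaches L (Suc E.candidates * (Suc n * L)) (separator w) (initial_store (encode_input P))
    (\<lambda>s'. s' 1 0 \<le> 3 + 2 * n \<and> (if \<exists>z<E.candidates. E.good z
      then \<exists>z<E.candidates. E.good z \<and> output_of s' = E.answer z else output_of s' = []))"
    by (rule E.reaches_separator) (simp_all add: initial_store_def)
  then obtain t s where run: "exec (separator w) (initial_store (encode_input P)) t s"
    "t \<le> prog_weight (separator w) * (Suc E.candidates * (Suc n * L))" "bounded L s" "s 1 0 \<le> 3 + 2 * n"
    and out: "if \<exists>z<E.candidates. E.good z
      then \<exists>z<E.candidates. E.good z \<and> output_of s = E.answer z else output_of s = []"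
    unfolding reaches_def by blast
  have x: "real_solution P $ i = E.x i" if "i < n" for i
    using real_solution_eq[OF that] by (simp add: E.x_def)
  have viol: "violated_inequality P r k S t S \<longleftrightarrow>
      row_point.violating n (rhs P $ r) (\<lambda>i. matrix P $$ (r, i)) E.x k S t" if r: "r < m" for r k S t
  proof -
    interpret R: row_point n "rhs P $ r" "\<lambda>i. matrix P $$ (r, i)" E.x by (rule E.is_row_point[OF r])
    have conf: "configuration (row (matrix P) r) (rhs P $ r) k S t \<longleftrightarrow> R.config k S t"
      using r by (intro R.configuration_iff_config) auto
    have "satisfies_configuration_inequality k S t (real_solution P) \<longleftrightarrow>
        (real (card S) - real k + 1) * E.x t + sum E.x S \<le> real (card S)" if "R.config k S t"
    proof -
      have "(\<Sum>i\<in>S. real_solution P $ i) = sum E.x S"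
        using that x by (intro sum.cong) (auto simp: R.config_def)
      then show ?thesis using that x by (simp add: satisfies_configuration_inequality_def R.config_def)
    qed
    then show ?thesis
      using r conf by (auto simp: violated_inequality_def R.violating_def not_le R.config_def)
  qed
  \<comment> \<open>The inequality depends on \<open>S\<close>, \<open>k\<close> and
    \<open>t\<close> only, and a configuration may be restricted from \<open>M\<close> to
    \<open>S\<close>. Hence it suffices to search and to answer with \<open>N = S\<close>.\<close>
  have shrink: "violated_inequality P r k S t S" if v: "violated_inequality P r k M t S" for r k M t S
  proof -
    have r: "r < m" using v by (simp add: violated_inequality_def)
    interpret R: row_point n "rhs P $ r" "\<lambda>i. matrix P $$ (r, i)" E.x by (rule E.is_row_point[OF r])
    have conf: "configuration (row (matrix P) r) (rhs P $ r) k S t \<longleftrightarrow> R.config k S t" for S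
      using r by (intro R.configuration_iff_config) auto
    show ?thesis using v R.config_subset[of k M t S] by (simp add: violated_inequality_def conf)
  qed
  have fracs: "{i. i < n \<and> 0 < E.x i \<and> E.x i < 1} = fractional P"
    using solution_range by (auto simp: fractional_def x[symmetric] real_solution_def dims)
  have "separates P (output_of s)"
  proof (cases "\<exists>z<E.candidates. E.good z")
    case True
    then obtain z where z: "z < E.candidates" "E.good z" "output_of s = E.answer z" using out by auto
    have r: "E.row_of z < m" using E.candidates_pos[OF z(1)] by (simp add: E.row_of_def)
    have "violated_inequality P (E.row_of z) (card (E.low z)) (E.chosen z) (E.t_of z) (E.chosen z)"
      using viol[OF r] E.good_imp_violating[OF z(1,2)] by blast
    moreover have "output_of s =
        encode_inequality P (E.row_of z) (card (E.low z)) (E.chosen z) (E.t_of z) (E.chosen z)"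
      using z(3) by (simp add: E.answer_def encode_inequality_def)
    ultimately show ?thesis unfolding separates_def by metis
  next
    case False
    have "\<not> violated_inequality P r k M t S" for r k M t S
    proof
      assume v: "violated_inequality P r k M t S"
      then have r: "r < m" by (simp add: violated_inequality_def)
      have "\<exists>z<E.candidates. E.good z"
        using E.violating_imp_good[OF r, of k S t \<alpha>] viol[OF r] shrink[OF v] few fracs w by simp
      then show False using False by blast
    qed
    then show ?thesis using False out by (simp add: separates_def)
  qed
  moreover have "t + word_size (output_of s) \<le>
      prog_weight (separator w) * (Suc (m * (n ^ 4 * (2 * n) ^ w)) * (Suc n * L)) + (3 + 2 * n) * L"
  proof -
    have "word_size (output_of s) \<le> s 1 0 * L" using run(3) E.L_ge(2) by (rule word_size_output_le)
    also have "\<dots> \<le> (3 + 2 * n) * L" using run(4) by (rule mult_le_mono1)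
    finally show ?thesis using run(2) unfolding E.candidates_def by linarith
  qed
  ultimately show ?thesis using run(1) by blast
qed

end

section \<open>The polynomial bound for a fixed number of fractional indices\<close>

theorem theorem5:
  fixes \<alpha> :: nat
  shows "solvable_in_poly_time {P. config_sp_input P \<and> card (fractional P) \<le> \<alpha>}
           encode_input separates"
proof -
  \<comment> \<open>Bounds the exceptional set of \<open>violating_near_base\<close> for at most
    \<open>\<alpha>\<close> fractional indices. It is a constant, so \<open>(2 * n) ^ w\<close> is
    polynomial in \<open>n\<close>.\<close>
  define w where "w = \<alpha> * \<alpha> + 2 * \<alpha>"
  define X :: "nat poly" where "X = [:0, 1:]"
  define l :: "nat poly" where "l = [:2 * w + 5:] * X"
  \<comment> \<open>The bound of \<open>separator_run\<close> with both dimensions replaced by the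
    size of the encoding, which neither of them exceeds.\<close>
  define f where "f = [:prog_weight (separator w):] * ((1 + X * (X ^ 4 * ([:2:] * X) ^ w)) * ((1 + X) * l)) +
    ([:3:] + [:2:] * X) * l"
  have "\<exists>t s. exec (separator w) (initial_store (encode_input P)) t s \<and>
      t + word_size (output_of s) \<le> poly f (word_size (encode_input P)) \<and> separates P (output_of s)"
    if P: "config_sp_input P" and few: "card (fractional P) \<le> \<alpha>" for P
  proof -
    let ?N = "word_size (encode_input P)" and ?m = "dim_row (matrix P)" and ?n = "dim_col (matrix P)"
    let ?L = "(2 * w + 5) * ?N"
    have mn: "?m \<le> ?N" "?n \<le> ?N"
      using length_le_word_size[of "encode_input P"] length_encode_input[OF P] by linarith+
    have "prog_weight (separator w) * (Suc (?m * (?n ^ 4 * (2 * ?n) ^ w)) * (Suc ?n * ?L)) + (3 + 2 * ?n) * ?L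
        \<le> prog_weight (separator w) * (Suc (?N * (?N ^ 4 * (2 * ?N) ^ w)) * (Suc ?N * ?L)) + (3 + 2 * ?N) * ?L"
      using mn by (intro add_mono mult_le_mono power_mono Suc_le_mono[THEN iffD2]) auto
    also have "\<dots> = poly f ?N" by (simp only: f_def l_def X_def poly_add poly_mult poly_power poly_pCons poly_0 poly_1
        mult_0_right mult_1_right add_0_right add_0_left Suc_eq_plus1_left)
    finally show ?thesis
      using separator_run[OF P few w_def refl refl] by (meson le_trans)
  qed
  then show ?thesis unfolding solvable_in_poly_time_def by blast
qed

end
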